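(* Let $S14$ be the bialgebra and $\tilde A,\tilde B,\tilde C,\tilde D,E,K$ the linear functionals on $S14$ defined in the context, and let $s14$ be the unital algebra they generate, with the bialgebra structure dual to that of $S14$. Then $$\tilde C=\tilde D\tilde B=-\tilde B\tilde D,\qquad [\tilde A,\tilde D]=0,\qquad \tilde A\tilde B=\tilde B\tilde A=\tilde D^2\tilde B=\tilde B^3=\tilde B,$$ $$EZ=ZE=0\quad\text{for }Z=\tilde A,\tilde B,\tilde D;$$ the coproduct is $$\delta(\tilde A)=\tilde A\otimes1+1\otimes\tilde A,\quad \delta(\tilde B)=\tilde B\otimes E+E\otimes\tilde B,\quad \delta(\tilde D)=\tilde D\otimes K+1\otimes\tilde D,\quad \delta(E)=E\otimes E,$$ where $K=(-1)^{\tilde A}$, and the counit is $\varepsilon(Z)=0$ for $Z=\tilde A,\tilde B,\tilde D$ and $\varepsilon(E)=1$. The elements $\tilde A$, $\tilde B^2$ and $\tilde D^2$ are Casimir operators (central). The bialgebra $s14$ is not a Hopf algebra (it admits no antipode).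
   Context: $S14$ is the unital associative $\mathbb{C}$-algebra generated by $\tilde a,\tilde b,\tilde c,\tilde d$ with relations $\tilde b\tilde c+\tilde c\tilde b=0$, $\tilde a\tilde d+\tilde d\tilde a=0$, $\tilde a\tilde b=\tilde b\tilde a=\tilde a\tilde c=\tilde c\tilde a=\tilde b\tilde d=\tilde d\tilde b=\tilde c\tilde d=\tilde d\tilde c=0$; it has basis $\tilde a^k\tilde d^\ell$, $\tilde b^k\tilde c^\ell$ ($k,\ell\ge0$, unit counted once). It is a bialgebra with $\delta\tilde a=\tilde a\otimes\tilde a+\tilde b\otimes\tilde b-\tilde c\otimes\tilde c+\tilde d\otimes\tilde d$, $\delta\tilde b=\tilde a\otimes\tilde b+\tilde b\otimes\tilde a-\tilde c\otimes\tilde d+\tilde d\otimes\tilde c$, $\delta\tilde c=\tilde a\otimes\tilde c+\tilde c\otimes\tilde a-\tilde b\otimes\tilde d+\tilde d\otimes\tilde b$, $\delta\tilde d=\tilde a\otimes\tilde d+\tilde d\otimes\tilde a-\tilde b\otimes\tilde c+\tilde c\otimes\tilde b$, $\varepsilon(\tilde a)=1$, $\varepsilon(\tilde b)=\varepsilon(\tilde c)=\varepsilon(\tilde d)=0$. Functionals: $\langle\tilde A,\tilde a^k\tilde d^\ell\rangle=k\delta_{\ell0}$, $\langle\tilde A,\tilde b^k\tilde c^\ell\rangle=0$; $\langle\tilde B,\tilde a^k\tilde d^\ell\rangle=0$, $\langle\tilde B,\tilde b^k\tilde c^\ell\rangle=\delta_{k1}\delta_{\ell0}$; $\langle\tilde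 C,\tilde a^k\tilde d^\ell\rangle=0$, $\langle\tilde C,\tilde b^k\tilde c^\ell\rangle=\delta_{k0}\delta_{\ell1}$; $\langle\tilde D,\tilde a^k\tilde d^\ell\rangle=\delta_{\ell1}$, $\langle\tilde D,\tilde b^k\tilde c^\ell\rangle=0$; $\langle E,f\rangle=1$ for $f=1$ and $0$ on all other basis elements. $K=(-1)^{\tilde A}$ is the functional $\langle K,\tilde a^k\tilde d^\ell\rangle=(-1)^k\delta_{\ell0}$, $\langle K,\tilde b^k\tilde c^\ell\rangle=0$ for $k+\ell\ge1$. Duality: the product of functionals is $\langle uv,f\rangle=\langle u\otimes v,\delta(f)\rangle$, the unit $1$ is the counit of $S14$, the coproduct is characterized by $\langle u,fg\rangle=\langle\delta(u),f\otimes g\rangle$ for all $f,g\in S14$, and the counit is $\varepsilon(u)=\langle u,1\rangle$. *)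

theory Defs
  imports Complex_Main "HOL-Library.Poly_Mapping"
begin

section \<open>Complex vector spaces and unital algebras\<close>

class scaleC =
  fixes scaleC :: "complex \<Rightarrow> 'a \<Rightarrow> 'a" (infixr \<open>*\<^sub>C\<close> 75)

class complex_vector = scaleC + ab_group_add +
  assumes scaleC_add_right: "c *\<^sub>C (x + y) = c *\<^sub>C x + c *\<^sub>C y"
    and scaleC_add_left: "(c + d) *\<^sub>C x = c *\<^sub>C x + d *\<^sub>C x"
    and scaleC_scaleC: "c *\<^sub>C d *\<^sub>C x = (c * d) *\<^sub>C x"
    and scaleC_one: "1 *\<^sub>C x = x"

(* Unlike ring_1, this class does not include 0 \<noteq> 1. *)
class complex_algebra = complex_vector + ring + monoid_mult +
  assumes mult_scaleC_left: "c *\<^sub>C x * y = c *\<^sub>C (x * y)"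
    and mult_scaleC_right: "x * c *\<^sub>C y = c *\<^sub>C (x * y)"

global_interpretation complex_vector: vector_space
  "scaleC :: complex \<Rightarrow> 'a \<Rightarrow> 'a::complex_vector"
  by unfold_locales (rule scaleC_add_right scaleC_add_left scaleC_scaleC scaleC_one)+

abbreviation clinear :: "('a::complex_vector \<Rightarrow> 'b::complex_vector) \<Rightarrow> bool"
  where "clinear \<equiv> Vector_Spaces.linear scaleC scaleC"

definition cbilinear ::
  "('a::complex_vector \<Rightarrow> 'b::complex_vector \<Rightarrow> 'c::complex_vector) \<Rightarrow> bool"
  where "cbilinear B \<longleftrightarrow> (\<forall>y. clinear (\<lambda>x. B x y)) \<and> (\<forall>x. clinear (B x))"

definition algebra_hom :: "('a::complex_algebra \<Rightarrow> 'b::complex_algebra) \<Rightarrow> bool"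
  where "algebra_hom h \<longleftrightarrow> clinear h \<and> h 1 = 1 \<and> (\<forall>x y. h (x * y) = h x * h y)"

inductive_set generated_subalgebra :: "'a::complex_algebra set \<Rightarrow> 'a set"
  for G :: "'a set"
  where
    gen: "x \<in> G \<Longrightarrow> x \<in> generated_subalgebra G"
  | one: "1 \<in> generated_subalgebra G"
  | add: "x \<in> generated_subalgebra G \<Longrightarrow> y \<in> generated_subalgebra G
      \<Longrightarrow> x + y \<in> generated_subalgebra G"
  | scale: "x \<in> generated_subalgebra G \<Longrightarrow> c *\<^sub>C x \<in> generated_subalgebra G"
  | mult: "x \<in> generated_subalgebra G \<Longrightarrow> y \<in> generated_subalgebra G
      \<Longrightarrow> x * y \<in> generated_subalgebra G"

lemma clinearI:
  assumes "\<And>x y. f (x + y) = f x + f y" "\<And>c x. f (c *\<^sub>C x) = c *\<^sub>C f x"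
  shows "clinear f"
  using assms by unfold_locales auto

lemma clinearD:
  assumes "clinear f"
  shows "f (x + y) = f x + f y" "f (c *\<^sub>C x) = c *\<^sub>C f x" "f 0 = 0" "f (- x) = - f x"
    "f (x - y) = f x - f y" "f (sum g A) = (\<Sum>k\<in>A. f (g k))"
proof -
  interpret l: Vector_Spaces.linear scaleC scaleC f by fact
  show "f (x + y) = f x + f y" "f (c *\<^sub>C x) = c *\<^sub>C f x" "f 0 = 0" "f (- x) = - f x"
    "f (x - y) = f x - f y" "f (sum g A) = (\<Sum>k\<in>A. f (g k))"
    by (rule l.add l.scale l.zero l.neg l.diff l.sum)+
qed

lemma cbilinearI:
  assumes "\<And>x x' y. B (x + x') y = B x y + B x' y" "\<And>c x y. B (c *\<^sub>C x) y = c *\<^sub>C B x y"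
    "\<And>x y y'. B x (y + y') = B x y + B x y'" "\<And>c x y. B x (c *\<^sub>C y) = c *\<^sub>C B x y"
  shows "cbilinear B"
  unfolding cbilinear_def using assms by (auto intro!: clinearI)

lemma cbilinearD:
  assumes "cbilinear B"
  shows "B (x + x') y = B x y + B x' y" "B (c *\<^sub>C x) y = c *\<^sub>C B x y"
    "B x (y + y') = B x y + B x y'" "B x (c *\<^sub>C y) = c *\<^sub>C B x y"
  using assms clinearD[of "\<lambda>x. B x y"] clinearD[of "B x"] unfolding cbilinear_def by auto

instantiation complex :: complex_algebra
begin
definition scaleC_complex where "scaleC_complex = ((*) :: complex \<Rightarrow> complex \<Rightarrow> complex)"
instance by standard (simp_all add: scaleC_complex_def algebra_simps)
end

instantiation poly_mapping :: (type, complex_vector) complex_vector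
begin
definition scaleC_poly_mapping :: "complex \<Rightarrow> ('a \<Rightarrow>\<^sub>0 'b) \<Rightarrow> 'a \<Rightarrow>\<^sub>0 'b"
  where "scaleC_poly_mapping c p = Poly_Mapping.map (scaleC c) p"
lemma lookup_scaleC:
  "Poly_Mapping.lookup (c *\<^sub>C p) k = c *\<^sub>C Poly_Mapping.lookup p k" for p :: "'a \<Rightarrow>\<^sub>0 'b"
  by (simp add: scaleC_poly_mapping_def Poly_Mapping.map.rep_eq when_def)
instance
  by standard
    (auto intro!: poly_mapping_eqI simp: lookup_scaleC lookup_add scaleC_add_right scaleC_add_left)
end

lemma scaleC_single: "c *\<^sub>C Poly_Mapping.single k d = Poly_Mapping.single k (c *\<^sub>C d)"
  by (rule poly_mapping_eqI) (simp add: lookup_scaleC lookup_single when_def)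

lemma poly_mapping_induct_single [case_names single add]:
  fixes p :: "'k \<Rightarrow>\<^sub>0 'b::ab_group_add"
  assumes "\<And>k c. P (Poly_Mapping.single k c)" "\<And>p q. P p \<Longrightarrow> P q \<Longrightarrow> P (p + q)"
  shows "P p"
proof (induction p rule: update_induct)
  case const
  show ?case using assms(1)[of undefined 0] by simp
next
  case (update p k c)
  have "Poly_Mapping.update k c p = p + Poly_Mapping.single k c"
    using update(1) by (intro poly_mapping_eqI)
      (auto simp: lookup_update lookup_add lookup_single when_def in_keys_iff)
  then show ?case using assms update by simp
qed


section \<open>Linear extension from a basis\<close>

definition extend_linearly :: "('k \<Rightarrow> 'v::complex_vector) \<Rightarrow> ('k \<Rightarrow>\<^sub>0 complex) \<Rightarrow> 'v"
  where "extend_linearly f p = (\<Sum>k\<in>Poly_Mapping.keys p. Poly_Mapping.lookup p k *\<^sub>C f k)"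

lemma extend_linearly_superset:
  assumes "finite S" "Poly_Mapping.keys p \<subseteq> S"
  shows "extend_linearly f p = (\<Sum>k\<in>S. Poly_Mapping.lookup p k *\<^sub>C f k)"
  unfolding extend_linearly_def using assms
  by (intro sum.mono_neutral_left) (auto simp: in_keys_iff)

lemma extend_linearly_single [simp]:
  "extend_linearly f (Poly_Mapping.single k c) = c *\<^sub>C f k"
  by (subst extend_linearly_superset[where S = "{k}"]) auto

lemma clinear_extend_linearly: "clinear (extend_linearly f)"
proof (rule clinearI)
  fix p q :: "'a \<Rightarrow>\<^sub>0 complex" and c
  let ?S = "Poly_Mapping.keys p \<union> Poly_Mapping.keys q"
  have "Poly_Mapping.keys (p + q) \<subseteq> ?S" by (rule Poly_Mapping.keys_add)
  then show "extend_linearly f (p + q) = extend_linearly f p + extend_linearly f q"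
    by (simp add: extend_linearly_superset[where S = ?S] lookup_add scaleC_add_left
        sum.distrib)
  have "Poly_Mapping.keys (c *\<^sub>C p) \<subseteq> Poly_Mapping.keys p"
    by (auto simp: in_keys_iff lookup_scaleC)
  then show "extend_linearly f (c *\<^sub>C p) = c *\<^sub>C extend_linearly f p"
    by (simp add: extend_linearly_superset[where S = "Poly_Mapping.keys p"] lookup_scaleC
        complex_vector.scale_sum_right scaleC_complex_def)
qed

lemmas extend_linearly_simps = clinearD[OF clinear_extend_linearly]

lemma clinear_zero_on_span:
  assumes "clinear f" "\<And>x. x \<in> S \<Longrightarrow> f x = 0" "x \<in> complex_vector.span S"
  shows "f x = 0"
  using assms(3) by (induction rule: complex_vector.span_induct_alt)
    (simp_all add: clinearD[OF assms(1)] assms(2))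


section \<open>Tensor products\<close>

definition tensor_relators ::
  "('a::complex_vector \<times> 'b::complex_vector \<Rightarrow>\<^sub>0 complex) set"
  where "tensor_relators =
    {Poly_Mapping.single (x + x', y) 1 - Poly_Mapping.single (x, y) 1
      - Poly_Mapping.single (x', y) 1 | x x' y. True} \<union>
    {Poly_Mapping.single (x, y + y') 1 - Poly_Mapping.single (x, y) 1
      - Poly_Mapping.single (x, y') 1 | x y y'. True} \<union>
    {Poly_Mapping.single (c *\<^sub>C x, y) 1 - c *\<^sub>C Poly_Mapping.single (x, y) 1 | c x y. True} \<union>
    {Poly_Mapping.single (x, c *\<^sub>C y) 1 - c *\<^sub>C Poly_Mapping.single (x, y) 1 | c x y. True}"

lemma equivp_span: "equivp (\<lambda>p q. p - q \<in> complex_vector.span S)"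
proof (rule equivpI)
  show "reflp (\<lambda>p q. p - q \<in> complex_vector.span S)"
    by (simp add: reflp_def complex_vector.span_zero)
  show "symp (\<lambda>p q. p - q \<in> complex_vector.span S)"
  proof (rule sympI)
    fix p q
    assume "p - q \<in> complex_vector.span S"
    then show "q - p \<in> complex_vector.span S"
      using complex_vector.span_neg[of "p - q" S] by simp
  qed
  show "transp (\<lambda>p q. p - q \<in> complex_vector.span S)"
  proof (rule transpI)
    fix p q r
    assume "p - q \<in> complex_vector.span S" "q - r \<in> complex_vector.span S"
    then have "(p - q) + (q - r) \<in> complex_vector.span S" by (rule complex_vector.span_add)
    then show "p - r \<in> complex_vector.span S" by simp
  qed
qed

quotient_type (overloaded) ('a, 'b) tensor =
  "'a::complex_vector \<times> 'b::complex_vector \<Rightarrow>\<^sub>0 complex" /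
  "\<lambda>p q. p - q \<in> complex_vector.span tensor_relators"
  by (rule equivp_span)

lemma span_diff_add:
  "\<lbrakk>p - p' \<in> complex_vector.span S; q - q' \<in> complex_vector.span S\<rbrakk>
    \<Longrightarrow> (p + q) - (p' + q') \<in> complex_vector.span S"
  using complex_vector.span_add[of "p - p'" S "q - q'"] by (simp add: algebra_simps)

lemma span_diff_diff:
  "\<lbrakk>p - p' \<in> complex_vector.span S; q - q' \<in> complex_vector.span S\<rbrakk>
    \<Longrightarrow> (p - q) - (p' - q') \<in> complex_vector.span S"
  using complex_vector.span_diff[of "p - p'" S "q - q'"] by (simp add: algebra_simps)

lemma span_diff_uminus:
  "p - p' \<in> complex_vector.span S \<Longrightarrow> - p - - p' \<in> complex_vector.span S"
  using complex_vector.span_neg[of "p - p'" S] by simp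

lemma span_diff_scale:
  "p - p' \<in> complex_vector.span S \<Longrightarrow> c *\<^sub>C p - c *\<^sub>C p' \<in> complex_vector.span S"
  using complex_vector.span_scale[of "p - p'" S c]
  by (simp add: complex_vector.scale_right_diff_distrib)

instantiation tensor :: (complex_vector, complex_vector) complex_vector
begin
lift_definition zero_tensor :: "('a, 'b) tensor" is 0 .
lift_definition plus_tensor :: "('a, 'b) tensor \<Rightarrow> ('a, 'b) tensor \<Rightarrow> ('a, 'b) tensor"
  is "(+)" by (rule span_diff_add)
lift_definition minus_tensor :: "('a, 'b) tensor \<Rightarrow> ('a, 'b) tensor \<Rightarrow> ('a, 'b) tensor"
  is "(-)" by (rule span_diff_diff)
lift_definition uminus_tensor :: "('a, 'b) tensor \<Rightarrow> ('a, 'b) tensor"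
  is uminus by (rule span_diff_uminus)
lift_definition scaleC_tensor :: "complex \<Rightarrow> ('a, 'b) tensor \<Rightarrow> ('a, 'b) tensor"
  is scaleC by (rule span_diff_scale)
instance
  by (standard; transfer)
    (simp_all add: complex_vector.span_zero algebra_simps scaleC_add_right scaleC_add_left)
end

lift_definition tensor_of ::
  "'a::complex_vector \<Rightarrow> 'b::complex_vector \<Rightarrow> ('a, 'b) tensor" (infixr \<open>\<otimes>\<close> 69)
  is "\<lambda>x y. Poly_Mapping.single (x, y) 1" .

(* The linear map determined by a bilinear map B; meaningful only if cbilinear B. *)
definition tensor_lift ::
  "('a::complex_vector \<Rightarrow> 'b::complex_vector \<Rightarrow> 'c::complex_vector) \<Rightarrow> ('a, 'b) tensor \<Rightarrow> 'c"
  where "tensor_lift B t = extend_linearly (\<lambda>(x, y). B x y) (rep_tensor t)"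

lemma tensor_add_left: "(x + x') \<otimes> y = x \<otimes> y + x' \<otimes> y"
  by transfer (rule complex_vector.span_base, force simp: tensor_relators_def algebra_simps)

lemma tensor_add_right: "x \<otimes> (y + y') = x \<otimes> y + x \<otimes> y'"
  by transfer (rule complex_vector.span_base, force simp: tensor_relators_def algebra_simps)

lemma tensor_scale_left: "(c *\<^sub>C x) \<otimes> y = c *\<^sub>C (x \<otimes> y)"
  by transfer (rule complex_vector.span_base, force simp: tensor_relators_def)

lemma tensor_scale_right: "x \<otimes> (c *\<^sub>C y) = c *\<^sub>C (x \<otimes> y)"
  by transfer (rule complex_vector.span_base, force simp: tensor_relators_def)

lemma cbilinear_tensor: "cbilinear (\<otimes>)"
  by (intro cbilinearI tensor_add_left tensor_add_right tensor_scale_left tensor_scale_right)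

lemma tensor_lift_add: "tensor_lift (\<lambda>x y. B x y + C x y) t = tensor_lift B t + tensor_lift C t"
  and tensor_lift_scale: "tensor_lift (\<lambda>x y. c *\<^sub>C B x y) t = c *\<^sub>C tensor_lift B t"
  by (simp_all add: tensor_lift_def extend_linearly_def case_prod_unfold scaleC_add_right
      sum.distrib complex_vector.scale_sum_right mult.commute)

lemma tensor_lift_abs:
  assumes "cbilinear B"
  shows "tensor_lift B (abs_tensor p) = extend_linearly (\<lambda>(x, y). B x y) p"
proof -
  let ?f = "extend_linearly (\<lambda>(x, y). B x y)"
  have "rep_tensor (abs_tensor p) - p \<in> complex_vector.span tensor_relators"
    by (rule Quotient3_rep_abs[OF Quotient3_tensor]) (simp add: complex_vector.span_zero)
  then have "?f (rep_tensor (abs_tensor p) - p) = 0"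
    by (rule clinear_zero_on_span[OF clinear_extend_linearly, rotated])
      (auto simp: tensor_relators_def extend_linearly_simps cbilinearD[OF assms])
  then show ?thesis by (simp add: tensor_lift_def extend_linearly_simps)
qed

lemma tensor_lift_tensor [simp]: "cbilinear B \<Longrightarrow> tensor_lift B (x \<otimes> y) = B x y"
  by (simp add: tensor_of.abs_eq tensor_lift_abs scaleC_one)

lemma clinear_tensor_lift:
  assumes "cbilinear B"
  shows "clinear (tensor_lift B)"
proof (rule clinearI)
  fix s t :: "('a, 'b) tensor" and c
  have "\<exists>p. r = abs_tensor p" for r :: "('a, 'b) tensor"
    by (induction r rule: tensor.abs_induct) blast
  then obtain p q where "s = abs_tensor p" "t = abs_tensor q"
    by blast
  then show "tensor_lift B (s + t) = tensor_lift B s + tensor_lift B t"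
    "tensor_lift B (c *\<^sub>C s) = c *\<^sub>C tensor_lift B s"
    by (simp_all add: plus_tensor.abs_eq scaleC_tensor.abs_eq tensor_lift_abs[OF assms]
        extend_linearly_simps)
qed

lemmas tensor_lift_simps = clinearD[OF clinear_tensor_lift]

lemma tensor_induct [case_names tensor add]:
  assumes "\<And>x y. P (x \<otimes> y)" "\<And>s t. P s \<Longrightarrow> P t \<Longrightarrow> P (s + t)"
  shows "P t"
proof -
  have "P (abs_tensor p)" for p
  proof (induction p rule: poly_mapping_induct_single)
    case (single k c)
    obtain x y where k: "k = (x, y)" by force
    have "(c *\<^sub>C x) \<otimes> y = abs_tensor (Poly_Mapping.single k c)"
      unfolding tensor_scale_left
      by (simp add: k tensor_of.abs_eq scaleC_tensor.abs_eq scaleC_single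
          scaleC_complex_def)
    then show ?case using assms(1)[of "c *\<^sub>C x" y] by simp
  next
    case (add p q)
    then show ?case using assms(2)[of "abs_tensor p" "abs_tensor q"]
      by (simp add: plus_tensor.abs_eq)
  qed
  then show ?thesis by (rule tensor.abs_induct)
qed

lemma clinear_tensor_eqI:
  assumes "clinear f" "clinear g" "\<And>x y. f (x \<otimes> y) = g (x \<otimes> y)"
  shows "f t = g t"
  by (induction t rule: tensor_induct) (simp_all add: assms clinearD[OF assms(1)] clinearD[OF assms(2)])

definition tensor_map ::
  "('a::complex_vector \<Rightarrow> 'c::complex_vector) \<Rightarrow> ('b::complex_vector \<Rightarrow> 'd::complex_vector)
    \<Rightarrow> ('a, 'b) tensor \<Rightarrow> ('c, 'd) tensor"
  where "tensor_map f g = tensor_lift (\<lambda>x y. f x \<otimes> g y)"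

definition tensor_assoc ::
  "(('a::complex_vector, 'b::complex_vector) tensor, 'c::complex_vector) tensor
    \<Rightarrow> ('a, ('b, 'c) tensor) tensor"
  where "tensor_assoc = tensor_lift (\<lambda>s z. tensor_lift (\<lambda>x y. x \<otimes> (y \<otimes> z)) s)"

lemma cbilinear_tensor_map: "clinear f \<Longrightarrow> clinear g \<Longrightarrow> cbilinear (\<lambda>x y. f x \<otimes> g y)"
  by (intro cbilinearI) (simp_all add: clinearD tensor_add_left tensor_add_right
      tensor_scale_left tensor_scale_right)

lemma tensor_map_tensor [simp]:
  "clinear f \<Longrightarrow> clinear g \<Longrightarrow> tensor_map f g (x \<otimes> y) = f x \<otimes> g y"
  by (simp add: tensor_map_def cbilinear_tensor_map)

lemma clinear_tensor_map: "clinear f \<Longrightarrow> clinear g \<Longrightarrow> clinear (tensor_map f g)"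
  by (simp add: tensor_map_def cbilinear_tensor_map clinear_tensor_lift)

lemma cbilinear_tensor_lift_param:
  assumes "\<And>z. cbilinear (\<lambda>x y. B x y z)" "\<And>x y. clinear (\<lambda>z. B x y z)"
  shows "cbilinear (\<lambda>s z. tensor_lift (\<lambda>x y. B x y z) s)"
    and "cbilinear (\<lambda>z s. tensor_lift (\<lambda>x y. B x y z) s)"
  by (intro cbilinearI; simp add: clinearD[OF assms(2)] tensor_lift_add tensor_lift_scale
      tensor_lift_simps assms(1))+

lemma cbilinear_tensor_assoc:
  "cbilinear (\<lambda>s z. tensor_lift (\<lambda>x y. x \<otimes> (y \<otimes> z)) s)"
  by (intro cbilinear_tensor_lift_param cbilinearI clinearI)
    (simp_all add: tensor_add_left tensor_add_right tensor_scale_left tensor_scale_right)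

lemma clinear_tensor_assoc: "clinear tensor_assoc"
  unfolding tensor_assoc_def by (intro clinear_tensor_lift cbilinear_tensor_assoc)

lemma cbilinear_tensor_assoc_aux: "cbilinear (\<lambda>x y. x \<otimes> (y \<otimes> z))"
  by (intro cbilinearI)
    (simp_all add: tensor_add_left tensor_add_right tensor_scale_left tensor_scale_right)

lemma tensor_assoc_tensor [simp]: "tensor_assoc ((x \<otimes> y) \<otimes> z) = x \<otimes> (y \<otimes> z)"
  unfolding tensor_assoc_def tensor_lift_tensor[OF cbilinear_tensor_assoc]
  by (rule tensor_lift_tensor[OF cbilinear_tensor_assoc_aux])

instantiation tensor :: (complex_algebra, complex_algebra) complex_algebra
begin
definition one_tensor :: "('a, 'b) tensor" where "1 = 1 \<otimes> 1"
definition times_tensor :: "('a, 'b) tensor \<Rightarrow> ('a, 'b) tensor \<Rightarrow> ('a, 'b) tensor"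
  where "s * t = tensor_lift (\<lambda>x y. tensor_lift (\<lambda>x' y'. (x * x') \<otimes> (y * y')) t) s"

lemma cbilinear_times_tensor_aux:
  "cbilinear (\<lambda>x' y'. (x * x') \<otimes> (y * y') :: ('a, 'b) tensor)"
  by (intro cbilinearI) (simp_all add: tensor_add_left tensor_add_right tensor_scale_left
      tensor_scale_right distrib_left mult_scaleC_right)

lemma cbilinear_times_tensor_aux2:
  "cbilinear (\<lambda>x y. tensor_lift (\<lambda>x' y'. (x * x') \<otimes> (y * y') :: ('a, 'b) tensor) t)"
  by (intro cbilinearI)
    (simp_all add: distrib_right mult_scaleC_left tensor_add_left tensor_add_right
      tensor_scale_left tensor_scale_right tensor_lift_add tensor_lift_scale)

lemma tensor_mult_tensor: "(x \<otimes> y) * (x' \<otimes> y') = (x * x') \<otimes> (y * y' :: 'b)" for x :: 'a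
  unfolding times_tensor_def tensor_lift_tensor[OF cbilinear_times_tensor_aux2]
  by (rule tensor_lift_tensor[OF cbilinear_times_tensor_aux])

lemma cbilinear_times_tensor: "cbilinear ((*) :: ('a, 'b) tensor \<Rightarrow> _)"
proof (intro cbilinearI)
  fix s s' t t' :: "('a, 'b) tensor" and c
  show "(s + s') * t = s * t + s' * t" "(c *\<^sub>C s) * t = c *\<^sub>C (s * t)"
    by (simp_all add: times_tensor_def tensor_lift_simps cbilinear_times_tensor_aux2)
  show "s * (t + t') = s * t + s * t'" "s * (c *\<^sub>C t) = c *\<^sub>C (s * t)"
    by (simp_all add: times_tensor_def tensor_lift_simps[OF cbilinear_times_tensor_aux]
        tensor_lift_add tensor_lift_scale)
qed

instance
proof
  note bil = cbilinearD[OF cbilinear_times_tensor]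
  fix r s t :: "('a, 'b) tensor" and c
  show "(r + s) * t = r * t + s * t" "r * (s + t) = r * s + r * t"
    "c *\<^sub>C r * s = c *\<^sub>C (r * s)" "r * c *\<^sub>C s = c *\<^sub>C (r * s)"
    by (rule bil)+
  show "1 * t = t" "t * 1 = t"
    by (induction t rule: tensor_induct) (simp_all add: one_tensor_def tensor_mult_tensor bil)
  show "r * s * t = r * (s * t)"
  proof (induction r rule: tensor_induct)
    case (tensor x y)
    show ?case
    proof (induction s rule: tensor_induct)
      case (tensor x' y')
      show ?case
        by (induction t rule: tensor_induct) (simp_all add: tensor_mult_tensor mult.assoc bil)
    qed (simp add: bil)
  qed (simp add: bil)
qed
end


lemma algebra_homI:
  assumes "clinear h" "h 1 = 1" "\<And>x y. h (x * y) = h x * h y"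
  shows "algebra_hom h"
  using assms by (simp add: algebra_hom_def)

lemma algebra_homD:
  assumes "algebra_hom h"
  shows "clinear h" "h 1 = 1" "h (x * y) = h x * h y"
  using assms by (simp_all add: algebra_hom_def)

lemma algebra_hom_id: "algebra_hom id"
  by (intro algebra_homI clinearI) simp_all

lemma algebra_hom_compose: "algebra_hom f \<Longrightarrow> algebra_hom g \<Longrightarrow> algebra_hom (\<lambda>x. f (g x))"
  by (intro algebra_homI clinearI) (simp_all add: algebra_homD clinearD[OF algebra_homD(1)])

lemma algebra_hom_tensor_lift:
  fixes B :: "'a::complex_algebra \<Rightarrow> 'b::complex_algebra \<Rightarrow> 'c::complex_algebra"
  assumes "cbilinear B" "B 1 1 = 1" "\<And>x x' y y'. B (x * x') (y * y') = B x y * B x' y'"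
  shows "algebra_hom (tensor_lift B)"
proof (rule algebra_homI)
  note [simp] = assms tensor_lift_simps[OF assms(1)]
  show "clinear (tensor_lift B)" using assms(1) by (rule clinear_tensor_lift)
  show "tensor_lift B 1 = 1" by (simp add: one_tensor_def)
  show "tensor_lift B (s * t) = tensor_lift B s * tensor_lift B t" for s t
  proof (induction s rule: tensor_induct)
    case (tensor x y)
    show ?case
      by (induction t rule: tensor_induct) (simp_all add: tensor_mult_tensor distrib_left)
  qed (simp add: distrib_right)
qed

lemma algebra_hom_tensor_map:
  assumes "algebra_hom f" "algebra_hom g"
  shows "algebra_hom (tensor_map f g)"
  unfolding tensor_map_def using assms
  by (intro algebra_hom_tensor_lift cbilinear_tensor_map)
    (simp_all add: algebra_homD tensor_mult_tensor one_tensor_def)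

lemma algebra_hom_tensor_assoc: "algebra_hom tensor_assoc"
proof (rule algebra_homI)
  note [simp] = tensor_mult_tensor clinearD[OF clinear_tensor_assoc] distrib_left distrib_right
    tensor_add_left
  show "clinear tensor_assoc" by (rule clinear_tensor_assoc)
  show "tensor_assoc 1 = 1" by (simp add: one_tensor_def)
  have *: "tensor_assoc ((p \<otimes> z) * (q \<otimes> w)) = tensor_assoc (p \<otimes> z) * tensor_assoc (q \<otimes> w)"
    for p q :: "('a, 'b) tensor" and z w :: 'c
  proof (induction p rule: tensor_induct)
    case (tensor x y)
    show ?case by (induction q rule: tensor_induct) simp_all
  qed simp
  show "tensor_assoc (s * t) = tensor_assoc s * tensor_assoc t"
    for s t :: "(('a, 'b) tensor, 'c) tensor"
  proof (induction s rule: tensor_induct)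
    case (tensor p z)
    show ?case by (induction t rule: tensor_induct) (simp_all add: * del: tensor_mult_tensor)
  qed simp
qed


section \<open>Bialgebras and Hopf algebras\<close>

definition bialgebra ::
  "('a::complex_algebra \<Rightarrow> ('a, 'a) tensor) \<Rightarrow> ('a \<Rightarrow> complex) \<Rightarrow> bool"
  where "bialgebra \<Delta> \<epsilon> \<longleftrightarrow>
    algebra_hom \<Delta> \<and> algebra_hom \<epsilon> \<and>
    (\<forall>x. tensor_assoc (tensor_map \<Delta> id (\<Delta> x)) = tensor_map id \<Delta> (\<Delta> x)) \<and>
    (\<forall>x. tensor_lift (\<lambda>y z. \<epsilon> y *\<^sub>C z) (\<Delta> x) = x) \<and>
    (\<forall>x. tensor_lift (\<lambda>y z. \<epsilon> z *\<^sub>C y) (\<Delta> x) = x)"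

definition antipode ::
  "('a::complex_algebra \<Rightarrow> ('a, 'a) tensor) \<Rightarrow> ('a \<Rightarrow> complex) \<Rightarrow> ('a \<Rightarrow> 'a) \<Rightarrow> bool"
  where "antipode \<Delta> \<epsilon> S \<longleftrightarrow> clinear S \<and>
    (\<forall>x. tensor_lift (\<lambda>y z. S y * z) (\<Delta> x) = \<epsilon> x *\<^sub>C 1) \<and>
    (\<forall>x. tensor_lift (\<lambda>y z. y * S z) (\<Delta> x) = \<epsilon> x *\<^sub>C 1)"

definition hopf_algebra ::
  "('a::complex_algebra \<Rightarrow> ('a, 'a) tensor) \<Rightarrow> ('a \<Rightarrow> complex) \<Rightarrow> bool"
  where "hopf_algebra \<Delta> \<epsilon> \<longleftrightarrow> bialgebra \<Delta> \<epsilon> \<and> (\<exists>S. antipode \<Delta> \<epsilon> S)"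


section \<open>The algebra S14\<close>

datatype gen = Gen_a | Gen_b | Gen_c | Gen_d

(* The free monoid, written additively so that gen_word \<Rightarrow>\<^sub>0 complex, with its
   convolution product, is the free unital algebra on gen. *)
datatype gen_word = Word (letters: "gen list")

instantiation gen_word :: monoid_add
begin
definition "0 = Word []"
definition "v + w = Word (letters v @ letters w)"
instance by standard (auto simp: zero_gen_word_def plus_gen_word_def)
end

type_synonym free_S14 = "gen_word \<Rightarrow>\<^sub>0 complex"

abbreviation free_gen :: "gen \<Rightarrow> free_S14"
  where "free_gen g \<equiv> Poly_Mapping.single (Word [g]) 1"

definition S14_relators :: "free_S14 set"
  where "S14_relators =
    (let a = free_gen Gen_a; b = free_gen Gen_b; c = free_gen Gen_c; d = free_gen Gen_d in
      {b * c + c * b, a * d + d * a,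
       a * b, b * a, a * c, c * a, b * d, d * b, c * d, d * c})"

lemma free_scale_left: "(c *\<^sub>C p) * q = c *\<^sub>C (p * q)"
  and free_scale_right: "p * (c *\<^sub>C q) = c *\<^sub>C (p * q)" for p q :: free_S14
proof -
  have *: "(c *\<^sub>C p) * q = c *\<^sub>C (p * q) \<and> p * (c *\<^sub>C q) = c *\<^sub>C (p * q)"
  proof (induction p rule: poly_mapping_induct_single)
    case (single k d)
    show ?case
      by (induction q rule: poly_mapping_induct_single)
        (simp_all add: scaleC_single mult_single scaleC_complex_def mult_ac distrib_left
          scaleC_add_right)
  qed (simp add: distrib_right scaleC_add_right)
  then show "(c *\<^sub>C p) * q = c *\<^sub>C (p * q)" "p * (c *\<^sub>C q) = c *\<^sub>C (p * q)" by simp_all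
qed

abbreviation S14_ideal :: "free_S14 set"
  where "S14_ideal \<equiv> complex_vector.span {p * r * q | p r q. r \<in> S14_relators}"

lemma S14_ideal_mult:
  assumes "x \<in> S14_ideal"
  shows "p * x \<in> S14_ideal" "x * p \<in> S14_ideal"
proof -
  have "p * x \<in> S14_ideal \<and> x * p \<in> S14_ideal" using assms
  proof (induction rule: complex_vector.span_induct_alt)
    case base
    then show ?case by (simp add: complex_vector.span_zero)
  next
    case (step c x y)
    then obtain p' r q' where x: "x = p' * r * q'" "r \<in> S14_relators" by blast
    have "p * x = (p * p') * r * q'" "x * p = p' * r * (q' * p)" by (simp_all add: x mult.assoc)
    then have "p * x \<in> S14_ideal" "x * p \<in> S14_ideal"
      using x(2) by (blast intro: complex_vector.span_base)+
    then show ?case using step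
      by (simp add: distrib_left distrib_right free_scale_left free_scale_right
          complex_vector.span_add complex_vector.span_scale)
  qed
  then show "p * x \<in> S14_ideal" "x * p \<in> S14_ideal" by simp_all
qed

lemma S14_ideal_eqI: "p = q \<Longrightarrow> p - q \<in> S14_ideal"
  by (simp add: complex_vector.span_zero)

quotient_type S14 = free_S14 / "\<lambda>p q. p - q \<in> S14_ideal"
  by (rule equivp_span)

instantiation S14 :: complex_algebra
begin
lift_definition zero_S14 :: S14 is 0 .
lift_definition one_S14 :: S14 is 1 .
lift_definition plus_S14 :: "S14 \<Rightarrow> S14 \<Rightarrow> S14" is "(+)" by (rule span_diff_add)
lift_definition minus_S14 :: "S14 \<Rightarrow> S14 \<Rightarrow> S14" is "(-)" by (rule span_diff_diff)
lift_definition uminus_S14 :: "S14 \<Rightarrow> S14" is uminus by (rule span_diff_uminus)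
lift_definition scaleC_S14 :: "complex \<Rightarrow> S14 \<Rightarrow> S14" is scaleC by (rule span_diff_scale)
lift_definition times_S14 :: "S14 \<Rightarrow> S14 \<Rightarrow> S14" is "(*)"
proof -
  fix p p' q q' :: free_S14
  assume "p - p' \<in> S14_ideal" "q - q' \<in> S14_ideal"
  then have "p * (q - q') + (p - p') * q' \<in> S14_ideal"
    by (intro complex_vector.span_add S14_ideal_mult)
  then show "p * q - p' * q' \<in> S14_ideal" by (simp add: algebra_simps)
qed
instance
  by (standard; transfer; rule S14_ideal_eqI)
    (simp_all add: distrib_left distrib_right mult.assoc add.assoc add.commute scaleC_add_right
      scaleC_add_left free_scale_left free_scale_right)
end

lift_definition S14_gen :: "gen \<Rightarrow> S14" is free_gen .

abbreviation "S14_a \<equiv> S14_gen Gen_a"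
abbreviation "S14_b \<equiv> S14_gen Gen_b"
abbreviation "S14_c \<equiv> S14_gen Gen_c"
abbreviation "S14_d \<equiv> S14_gen Gen_d"

lemma S14_relations [simp]:
  "S14_c * S14_b = - (S14_b * S14_c)" "S14_d * S14_a = - (S14_a * S14_d)"
  "S14_a * S14_b = 0" "S14_b * S14_a = 0" "S14_a * S14_c = 0" "S14_c * S14_a = 0"
  "S14_b * S14_d = 0" "S14_d * S14_b = 0" "S14_c * S14_d = 0" "S14_d * S14_c = 0"
proof -
  have *: "r \<in> S14_ideal" if "r \<in> S14_relators" for r
  proof -
    have "1 * r * 1 \<in> S14_ideal" using that by (intro complex_vector.span_base) blast
    then show ?thesis by simp
  qed
  let ?a = "free_gen Gen_a" and ?b = "free_gen Gen_b"
    and ?c = "free_gen Gen_c" and ?d = "free_gen Gen_d"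
  have eq: "q * p - - (p * q) = p * q + q * p" for p q :: free_S14
    by (simp add: add.commute)
  have "?b * ?c + ?c * ?b \<in> S14_relators" "?a * ?d + ?d * ?a \<in> S14_relators"
    by (simp_all only: S14_relators_def Let_def insert_iff simp_thms)
  note r = this[THEN *, folded eq]
  show "S14_c * S14_b = - (S14_b * S14_c)" by transfer (rule r)
  show "S14_d * S14_a = - (S14_a * S14_d)" by transfer (rule r)
  have "?a * ?b \<in> S14_relators" "?b * ?a \<in> S14_relators" "?a * ?c \<in> S14_relators"
    "?c * ?a \<in> S14_relators" "?b * ?d \<in> S14_relators" "?d * ?b \<in> S14_relators"
    "?c * ?d \<in> S14_relators" "?d * ?c \<in> S14_relators"
    by (simp_all only: S14_relators_def Let_def insert_iff simp_thms)
  note r = this[THEN *]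
  show "S14_a * S14_b = 0" "S14_b * S14_a = 0" "S14_a * S14_c = 0" "S14_c * S14_a = 0"
    "S14_b * S14_d = 0" "S14_d * S14_b = 0" "S14_c * S14_d = 0" "S14_d * S14_c = 0"
    by (transfer, unfold diff_0_right, rule r)+
qed

definition free_lift :: "(gen \<Rightarrow> 'a::complex_algebra) \<Rightarrow> free_S14 \<Rightarrow> 'a"
  where "free_lift \<phi> = extend_linearly (\<lambda>w. prod_list (map \<phi> (letters w)))"

(* The algebra homomorphism determined by the images of the generators; meaningful only if
   these satisfy the defining relations. *)
definition S14_lift :: "(gen \<Rightarrow> 'a::complex_algebra) \<Rightarrow> S14 \<Rightarrow> 'a"
  where "S14_lift \<phi> x = free_lift \<phi> (rep_S14 x)"

lemma clinear_free_lift: "clinear (free_lift \<phi>)"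
  unfolding free_lift_def by (rule clinear_extend_linearly)

lemma free_lift_gen [simp]: "free_lift \<phi> (free_gen g) = \<phi> g"
  by (simp add: free_lift_def scaleC_one)

lemma free_lift_one [simp]: "free_lift \<phi> 1 = 1"
  by (simp add: free_lift_def scaleC_one zero_gen_word_def flip: single_one)

lemma free_lift_mult [simp]: "free_lift \<phi> (p * q) = free_lift \<phi> p * free_lift \<phi> q"
proof (induction p rule: poly_mapping_induct_single)
  case (single v c)
  show ?case
    by (induction q rule: poly_mapping_induct_single)
      (simp_all add: clinearD[OF clinear_free_lift] distrib_left,
       simp add: free_lift_def mult_single plus_gen_word_def mult_scaleC_left mult_scaleC_right
         scaleC_scaleC mult.commute)
qed (simp add: clinearD[OF clinear_free_lift] distrib_right)

lemma S14_lift_abs: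
  assumes "\<And>r. r \<in> S14_relators \<Longrightarrow> free_lift \<phi> r = 0"
  shows "S14_lift \<phi> (abs_S14 p) = free_lift \<phi> p"
proof -
  have "rep_S14 (abs_S14 p) - p \<in> S14_ideal"
    by (rule Quotient3_rep_abs[OF Quotient3_S14]) (simp add: complex_vector.span_zero)
  then have "free_lift \<phi> (rep_S14 (abs_S14 p) - p) = 0"
    by (rule clinear_zero_on_span[OF clinear_free_lift, rotated]) (auto simp: assms)
  then show ?thesis by (simp add: S14_lift_def clinearD[OF clinear_free_lift])
qed

lemma S14_lift:
  assumes "\<And>r. r \<in> S14_relators \<Longrightarrow> free_lift \<phi> r = 0"
  shows "algebra_hom (S14_lift \<phi>)" "S14_lift \<phi> (S14_gen g) = \<phi> g"
proof -
  have ex: "\<exists>p. x = abs_S14 p" for x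
    by (induction x rule: S14.abs_induct) blast
  note [simp] = S14_lift_abs[OF assms] clinearD[OF clinear_free_lift]
  show "algebra_hom (S14_lift \<phi>)"
  proof (intro algebra_homI clinearI)
    fix x y c
    obtain p q where [simp]: "x = abs_S14 p" "y = abs_S14 q" using ex by blast
    show "S14_lift \<phi> (x + y) = S14_lift \<phi> x + S14_lift \<phi> y"
      "S14_lift \<phi> (c *\<^sub>C x) = c *\<^sub>C S14_lift \<phi> x"
      "S14_lift \<phi> (x * y) = S14_lift \<phi> x * S14_lift \<phi> y"
      by (simp_all add: plus_S14.abs_eq scaleC_S14.abs_eq times_S14.abs_eq)
    show "S14_lift \<phi> 1 = 1" by (simp add: one_S14.abs_eq)
  qed
  show "S14_lift \<phi> (S14_gen g) = \<phi> g" by (simp add: S14_gen.abs_eq)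
qed

lemma S14_word: "abs_S14 (Poly_Mapping.single w 1) = prod_list (map S14_gen (letters w))"
proof (cases w)
  case (Word gs)
  have "abs_S14 (Poly_Mapping.single (Word gs) 1) = prod_list (map S14_gen gs)"
  proof (induction gs)
    case Nil
    show ?case by (simp add: one_S14.abs_eq flip: zero_gen_word_def)
  next
    case (Cons g gs)
    have "Poly_Mapping.single (Word (g # gs)) 1 = free_gen g * Poly_Mapping.single (Word gs) 1"
      by (simp add: mult_single plus_gen_word_def)
    then show ?case using Cons by (simp add: S14_gen.abs_eq flip: times_S14.abs_eq)
  qed
  then show ?thesis by (simp add: Word)
qed

lemma S14_induct [case_names word add scale]:
  assumes "\<And>gs. P (prod_list (map S14_gen gs))" "\<And>x y. P x \<Longrightarrow> P y \<Longrightarrow> P (x + y)"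
    "\<And>c x. P x \<Longrightarrow> P (c *\<^sub>C x)"
  shows "P x"
proof -
  have "P (abs_S14 p)" for p
  proof (induction p rule: poly_mapping_induct_single)
    case (single w c)
    have "Poly_Mapping.single w c = c *\<^sub>C Poly_Mapping.single w 1"
      by (simp add: scaleC_single scaleC_complex_def)
    then show ?case using assms(1,3) by (simp add: S14_word flip: scaleC_S14.abs_eq)
  next
    case (add p q)
    then show ?case using assms(2) by (simp flip: plus_S14.abs_eq)
  qed
  then show ?thesis by (rule S14.abs_induct)
qed

lemma S14_hom_eqI:
  assumes f: "algebra_hom f" and g: "algebra_hom g" and "\<And>z. f (S14_gen z) = g (S14_gen z)"
  shows "f x = g x"
proof (induction x rule: S14_induct)
  case (word gs)
  show ?case by (induction gs) (simp_all add: algebra_homD[OF f] algebra_homD[OF g] assms(3))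
qed (simp_all add: clinearD[OF algebra_homD(1)[OF f]] clinearD[OF algebra_homD(1)[OF g]])

definition S14_comult :: "S14 \<Rightarrow> (S14, S14) tensor"
  where "S14_comult = S14_lift (\<lambda>g. case g of
      Gen_a \<Rightarrow> S14_a \<otimes> S14_a + S14_b \<otimes> S14_b - S14_c \<otimes> S14_c + S14_d \<otimes> S14_d
    | Gen_b \<Rightarrow> S14_a \<otimes> S14_b + S14_b \<otimes> S14_a - S14_c \<otimes> S14_d + S14_d \<otimes> S14_c
    | Gen_c \<Rightarrow> S14_a \<otimes> S14_c + S14_c \<otimes> S14_a - S14_b \<otimes> S14_d + S14_d \<otimes> S14_b
    | Gen_d \<Rightarrow> S14_a \<otimes> S14_d + S14_d \<otimes> S14_a - S14_b \<otimes> S14_c + S14_c \<otimes> S14_b)"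

definition S14_counit :: "S14 \<Rightarrow> complex"
  where "S14_counit = S14_lift (\<lambda>g. if g = Gen_a then 1 else 0)"

lemmas tensor_simps = tensor_add_left tensor_add_right tensor_scale_left tensor_scale_right

lemma tensor_more_simps:
  "(- x) \<otimes> y = - (x \<otimes> y)" "x \<otimes> (- y) = - (x \<otimes> y)"
  "(x - x') \<otimes> y = x \<otimes> y - x' \<otimes> y" "x \<otimes> (y - y') = x \<otimes> y - x \<otimes> y'"
  "0 \<otimes> y = 0" "x \<otimes> 0 = 0"
proof -
  have l: "clinear (\<lambda>x. x \<otimes> y)" and r: "clinear (\<lambda>y. x \<otimes> y)" for x y
    using cbilinear_tensor unfolding cbilinear_def by blast+
  show "(- x) \<otimes> y = - (x \<otimes> y)" "x \<otimes> (- y) = - (x \<otimes> y)"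
    "(x - x') \<otimes> y = x \<otimes> y - x' \<otimes> y" "x \<otimes> (y - y') = x \<otimes> y - x \<otimes> y'"
    "0 \<otimes> y = 0" "x \<otimes> 0 = 0"
    by (simp_all only: clinearD[OF l] clinearD[OF r])
qed

lemma S14_comult:
  "algebra_hom S14_comult"
  "S14_comult S14_a = S14_a \<otimes> S14_a + S14_b \<otimes> S14_b - S14_c \<otimes> S14_c + S14_d \<otimes> S14_d"
  "S14_comult S14_b = S14_a \<otimes> S14_b + S14_b \<otimes> S14_a - S14_c \<otimes> S14_d + S14_d \<otimes> S14_c"
  "S14_comult S14_c = S14_a \<otimes> S14_c + S14_c \<otimes> S14_a - S14_b \<otimes> S14_d + S14_d \<otimes> S14_b"
  "S14_comult S14_d = S14_a \<otimes> S14_d + S14_d \<otimes> S14_a - S14_b \<otimes> S14_c + S14_c \<otimes> S14_b"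
proof -
  let ?\<phi> = "\<lambda>g. case g of
      Gen_a \<Rightarrow> S14_a \<otimes> S14_a + S14_b \<otimes> S14_b - S14_c \<otimes> S14_c + S14_d \<otimes> S14_d
    | Gen_b \<Rightarrow> S14_a \<otimes> S14_b + S14_b \<otimes> S14_a - S14_c \<otimes> S14_d + S14_d \<otimes> S14_c
    | Gen_c \<Rightarrow> S14_a \<otimes> S14_c + S14_c \<otimes> S14_a - S14_b \<otimes> S14_d + S14_d \<otimes> S14_b
    | Gen_d \<Rightarrow> S14_a \<otimes> S14_d + S14_d \<otimes> S14_a - S14_b \<otimes> S14_c + S14_c \<otimes> S14_b"
  have *: "free_lift ?\<phi> r = 0" if "r \<in> S14_relators" for r
    using that unfolding S14_relators_def Let_def
    by (elim insertE emptyE; simp add: clinearD[OF clinear_free_lift] distrib_left distrib_right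
        left_diff_distrib right_diff_distrib tensor_mult_tensor tensor_more_simps)
  show "algebra_hom S14_comult"
    unfolding S14_comult_def by (rule S14_lift(1)[OF *])
  have "S14_comult (S14_gen g) = ?\<phi> g" for g
    unfolding S14_comult_def by (rule S14_lift(2)[OF *])
  from this[of Gen_a] this[of Gen_b] this[of Gen_c] this[of Gen_d] show
    "S14_comult S14_a = S14_a \<otimes> S14_a + S14_b \<otimes> S14_b - S14_c \<otimes> S14_c + S14_d \<otimes> S14_d"
    "S14_comult S14_b = S14_a \<otimes> S14_b + S14_b \<otimes> S14_a - S14_c \<otimes> S14_d + S14_d \<otimes> S14_c"
    "S14_comult S14_c = S14_a \<otimes> S14_c + S14_c \<otimes> S14_a - S14_b \<otimes> S14_d + S14_d \<otimes> S14_b"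
    "S14_comult S14_d = S14_a \<otimes> S14_d + S14_d \<otimes> S14_a - S14_b \<otimes> S14_c + S14_c \<otimes> S14_b"
    by simp_all
qed

lemma S14_counit:
  "algebra_hom S14_counit" "S14_counit (S14_gen g) = (if g = Gen_a then 1 else 0)"
proof -
  have *: "free_lift (\<lambda>g. if g = Gen_a then 1 else 0 :: complex) r = 0" if "r \<in> S14_relators" for r
    using that unfolding S14_relators_def Let_def
    by (elim insertE emptyE; simp add: clinearD[OF clinear_free_lift])
  show "algebra_hom S14_counit"
    unfolding S14_counit_def by (rule S14_lift(1)[OF *])
  show "S14_counit (S14_gen g) = (if g = Gen_a then 1 else 0)"
    unfolding S14_counit_def by (rule S14_lift(2)[OF *])
qed

lemma cbilinear_scale_left: "clinear (f :: _ \<Rightarrow> complex) \<Longrightarrow> cbilinear (\<lambda>y z. f y *\<^sub>C z)"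
  and cbilinear_scale_right: "clinear (f :: _ \<Rightarrow> complex) \<Longrightarrow> cbilinear (\<lambda>y z. f z *\<^sub>C y)"
  by (intro cbilinearI; simp add: clinearD scaleC_complex_def scaleC_add_left scaleC_add_right
      scaleC_scaleC mult.commute)+

lemma bialgebra_S14: "bialgebra S14_comult S14_counit"
  unfolding bialgebra_def
proof (intro conjI allI)
  note [simp] = clinearD[OF algebra_homD(1)[OF S14_comult(1)]]
    clinearD[OF algebra_homD(1)[OF S14_counit(1)]] algebra_homD[OF S14_comult(1)]
    algebra_homD[OF S14_counit(1)] S14_comult(2-) S14_counit(2)
  have id: "clinear (id :: S14 \<Rightarrow> S14)" by (rule algebra_homD(1)[OF algebra_hom_id])
  show "algebra_hom S14_comult" "algebra_hom S14_counit" by (rule S14_comult S14_counit)+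
  fix x
  show "tensor_assoc (tensor_map S14_comult id (S14_comult x)) =
    tensor_map id S14_comult (S14_comult x)"
  proof (rule S14_hom_eqI[where x = x])
    note h = algebra_hom_tensor_map[OF S14_comult(1) algebra_hom_id]
      algebra_hom_tensor_map[OF algebra_hom_id S14_comult(1)]
    show "algebra_hom (\<lambda>x. tensor_assoc (tensor_map S14_comult id (S14_comult x)))"
      by (rule algebra_hom_compose[OF algebra_hom_tensor_assoc
            algebra_hom_compose[OF h(1) S14_comult(1)]])
    show "algebra_hom (\<lambda>x. tensor_map id S14_comult (S14_comult x))"
      by (rule algebra_hom_compose[OF h(2) S14_comult(1)])
    fix g
    note [simp] = clinearD[OF clinear_tensor_assoc] tensor_more_simps tensor_simps id
      clinearD[OF clinear_tensor_map[OF id algebra_homD(1)[OF S14_comult(1)]]]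
      clinearD[OF clinear_tensor_map[OF algebra_homD(1)[OF S14_comult(1)] id]]
    show "tensor_assoc (tensor_map S14_comult id (S14_comult (S14_gen g))) =
      tensor_map id S14_comult (S14_comult (S14_gen g))"
      by (cases g) simp_all
  qed
  have l: "cbilinear (\<lambda>y z. S14_counit y *\<^sub>C z)" and r: "cbilinear (\<lambda>y z. S14_counit z *\<^sub>C y)"
    for y z :: S14
    by (intro cbilinear_scale_left cbilinear_scale_right algebra_homD(1) S14_counit)+
  note [simp] = tensor_lift_tensor[OF l] tensor_lift_simps[OF l]
    tensor_lift_tensor[OF r] tensor_lift_simps[OF r] scaleC_one
  have hom: "algebra_hom (tensor_lift (\<lambda>y z. S14_counit y *\<^sub>C z :: S14))"
    "algebra_hom (tensor_lift (\<lambda>y z. S14_counit z *\<^sub>C y :: S14))"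
    by (intro algebra_hom_tensor_lift l r;
        simp add: mult_scaleC_left mult_scaleC_right scaleC_scaleC mult.commute)+
  have eq: "tensor_lift (\<lambda>y z. S14_counit y *\<^sub>C z) (S14_comult (S14_gen g)) = S14_gen g"
    "tensor_lift (\<lambda>y z. S14_counit z *\<^sub>C y) (S14_comult (S14_gen g)) = S14_gen g" for g
    by (cases g; simp)+
  show "tensor_lift (\<lambda>y z. S14_counit y *\<^sub>C z) (S14_comult x) = x"
    using S14_hom_eqI[OF algebra_hom_compose[OF hom(1) S14_comult(1)] algebra_hom_id, of x]
    by (simp add: eq)
  show "tensor_lift (\<lambda>y z. S14_counit z *\<^sub>C y) (S14_comult x) = x"
    using S14_hom_eqI[OF algebra_hom_compose[OF hom(2) S14_comult(1)] algebra_hom_id, of x]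
    by (simp add: eq)
qed


section \<open>The algebra of linear functionals on S14\<close>

typedef S14_functional = "{u :: S14 \<Rightarrow> complex. clinear u}"
  morphisms functional_apply Abs_S14_functional
  by (rule exI[of _ "\<lambda>_. 0"]) (auto intro!: clinearI)

setup_lifting type_definition_S14_functional

lemma clinear_functional_apply: "clinear (functional_apply u)"
  using functional_apply[of u] by simp

lemma cbilinear_functional_mult:
  "clinear u \<Longrightarrow> clinear v \<Longrightarrow> cbilinear (\<lambda>f g. u f * v g :: complex)"
  by (intro cbilinearI) (simp_all add: clinearD scaleC_complex_def algebra_simps)

lemma clinear_convolution:
  "clinear u \<Longrightarrow> clinear v \<Longrightarrow>
    clinear (\<lambda>f. tensor_lift (\<lambda>x y. u x * v y :: complex) (S14_comult f))"
  using clinearD[OF algebra_homD(1)[OF S14_comult(1)]]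
    tensor_lift_simps[OF cbilinear_functional_mult[of u v]]
  by (intro clinearI) simp_all

lemma tensor_lift_tensor_map:
  assumes "clinear f" "clinear g" "cbilinear B"
  shows "tensor_lift B (tensor_map f g t) = tensor_lift (\<lambda>x y. B (f x) (g y)) t"
proof -
  have B: "cbilinear (\<lambda>x y. B (f x) (g y))"
    using assms by (intro cbilinearI) (simp_all add: clinearD cbilinearD)
  show ?thesis
    by (rule clinear_tensor_eqI[where t = t], intro clinearI)
      (simp_all add: tensor_lift_simps assms B clinear_tensor_lift
        clinearD[OF clinear_tensor_map[OF assms(1,2)]])
qed

lemma convolution_assoc:
  fixes u v w :: "S14 \<Rightarrow> complex"
  assumes u: "clinear u" and v: "clinear v" and w: "clinear w"
  shows "tensor_lift (\<lambda>x y. tensor_lift (\<lambda>x y. u x * v y) (S14_comult x) * w y) (S14_comult f) =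
    tensor_lift (\<lambda>x y. u x * tensor_lift (\<lambda>x y. v x * w y) (S14_comult y)) (S14_comult f)"
proof -
  note bil = cbilinear_functional_mult
  note lift = clinear_tensor_lift[OF bil]
  note d = algebra_homD(1)[OF S14_comult(1)]
  have id: "clinear (id :: S14 \<Rightarrow> S14)" by (rule algebra_homD(1)[OF algebra_hom_id])
  let ?uv = "tensor_lift (\<lambda>x y. u x * v y)" and ?vw = "tensor_lift (\<lambda>x y. v x * w y)"
  have assoc: "tensor_lift (\<lambda>s y. ?uv s * w y) t =
      tensor_lift (\<lambda>x s. u x * ?vw s) (tensor_assoc t)" for t
  proof (induction t rule: tensor_induct)
    case (tensor s z)
    show ?case
      by (induction s rule: tensor_induct)
        (simp_all add: bil lift u v w tensor_lift_simps tensor_add_left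
          clinearD[OF clinear_tensor_assoc] distrib_right)
  qed (simp_all add: bil lift u v w tensor_lift_simps clinearD[OF clinear_tensor_assoc])
  have "tensor_lift (\<lambda>x y. ?uv (S14_comult x) * w y) (S14_comult f) =
      tensor_lift (\<lambda>s y. ?uv s * w y) (tensor_map S14_comult id (S14_comult f))"
    by (simp add: tensor_lift_tensor_map d id bil lift u v w)
  also have "\<dots> = tensor_lift (\<lambda>x s. u x * ?vw s) (tensor_map id S14_comult (S14_comult f))"
    using bialgebra_S14 by (simp add: assoc bialgebra_def)
  also have "\<dots> = tensor_lift (\<lambda>x y. u x * ?vw (S14_comult y)) (S14_comult f)"
    by (simp add: tensor_lift_tensor_map d id bil lift u v w)
  finally show ?thesis .
qed

lemma convolution_counit:
  fixes u :: "S14 \<Rightarrow> complex"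
  assumes u: "clinear u"
  shows "tensor_lift (\<lambda>x y. S14_counit x * u y) (S14_comult f) = u f"
    and "tensor_lift (\<lambda>x y. u x * S14_counit y) (S14_comult f) = u f"
proof -
  have e: "clinear S14_counit" by (rule algebra_homD(1)[OF S14_counit(1)])
  note bil = cbilinear_functional_mult[OF e u] cbilinear_functional_mult[OF u e]
    cbilinear_scale_left[OF e] cbilinear_scale_right[OF e]
  have "tensor_lift (\<lambda>x y. S14_counit x * u y) t = u (tensor_lift (\<lambda>x y. S14_counit x *\<^sub>C y) t)"
    "tensor_lift (\<lambda>x y. u x * S14_counit y) t = u (tensor_lift (\<lambda>x y. S14_counit y *\<^sub>C x) t)" for t
    by (induction t rule: tensor_induct)
      (simp_all add: bil tensor_lift_simps clinearD[OF u] scaleC_complex_def)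
  then show "tensor_lift (\<lambda>x y. S14_counit x * u y) (S14_comult f) = u f"
    "tensor_lift (\<lambda>x y. u x * S14_counit y) (S14_comult f) = u f"
    using bialgebra_S14 by (simp_all add: bialgebra_def)
qed

instantiation S14_functional :: complex_algebra
begin
lift_definition zero_S14_functional :: S14_functional is "\<lambda>_. 0" by (auto intro!: clinearI)
lift_definition one_S14_functional :: S14_functional is S14_counit
  by (rule algebra_homD(1)[OF S14_counit(1)])
lift_definition plus_S14_functional :: "S14_functional \<Rightarrow> S14_functional \<Rightarrow> S14_functional"
  is "\<lambda>u v f. u f + v f"
  by (intro clinearI) (simp_all add: clinearD scaleC_complex_def algebra_simps)
lift_definition minus_S14_functional :: "S14_functional \<Rightarrow> S14_functional \<Rightarrow> S14_functional"
  is "\<lambda>u v f. u f - v f"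
  by (intro clinearI) (simp_all add: clinearD scaleC_complex_def algebra_simps)
lift_definition uminus_S14_functional :: "S14_functional \<Rightarrow> S14_functional"
  is "\<lambda>u f. - u f"
  by (intro clinearI) (simp_all add: clinearD scaleC_complex_def algebra_simps)
lift_definition scaleC_S14_functional :: "complex \<Rightarrow> S14_functional \<Rightarrow> S14_functional"
  is "\<lambda>c u f. c * u f"
  by (intro clinearI) (simp_all add: clinearD scaleC_complex_def algebra_simps)
lift_definition times_S14_functional :: "S14_functional \<Rightarrow> S14_functional \<Rightarrow> S14_functional"
  is "\<lambda>u v f. tensor_lift (\<lambda>x y. u x * v y) (S14_comult f)"
  by (rule clinear_convolution)
instance
proof
  fix u v w :: S14_functional and c :: complex
  show "u * v * w = u * (v * w)"
    by transfer (rule ext, rule convolution_assoc)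
  show "1 * u = u" "u * 1 = u"
    by (transfer, rule ext, rule convolution_counit, assumption)+
  show "(u + v) * w = u * w + v * w" "u * (v + w) = u * v + u * w"
    by (transfer, simp add: distrib_left distrib_right tensor_lift_add)+
  have s: "tensor_lift (\<lambda>x y. c * B x y) t = c * tensor_lift B t"
    for B :: "S14 \<Rightarrow> S14 \<Rightarrow> complex" and c t
    using tensor_lift_scale[of c B t] by (simp add: scaleC_complex_def)
  show "c *\<^sub>C u * v = c *\<^sub>C (u * v)" "u * c *\<^sub>C v = c *\<^sub>C (u * v)"
    by (transfer, simp add: s mult.assoc mult.left_commute)+
qed (transfer, simp add: fun_eq_iff algebra_simps)+
end


section \<open>Functionals given by their values on a basis\<close>

(* The sign picked up when every d is moved past the a's to its right and every c past the
   b's to its right. *)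
fun word_sign :: "gen list \<Rightarrow> complex"
  where
    "word_sign [] = 1"
  | "word_sign (g # gs) =
      (case g of Gen_c \<Rightarrow> (- 1) ^ count_list gs Gen_b | Gen_d \<Rightarrow> (- 1) ^ count_list gs Gen_a | _ \<Rightarrow> 1)
      * word_sign gs"

definition word_value :: "(nat \<Rightarrow> nat \<Rightarrow> complex) \<Rightarrow> (nat \<Rightarrow> nat \<Rightarrow> complex) \<Rightarrow> gen list \<Rightarrow> complex"
  where "word_value p q gs =
    (if set gs \<subseteq> {Gen_a, Gen_d} then word_sign gs * p (count_list gs Gen_a) (count_list gs Gen_d)
     else if set gs \<subseteq> {Gen_b, Gen_c} then word_sign gs * q (count_list gs Gen_b) (count_list gs Gen_c)
     else 0)"

lemma word_sign_swap:
  "word_sign (v @ Gen_d # Gen_a # w) = - word_sign (v @ Gen_a # Gen_d # w)"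
  "word_sign (v @ Gen_c # Gen_b # w) = - word_sign (v @ Gen_b # Gen_c # w)"
  by (induction v) (auto split: gen.split)

lemma word_value_relations:
  "word_value p q (v @ Gen_d # Gen_a # w) = - word_value p q (v @ Gen_a # Gen_d # w)"
  "word_value p q (v @ Gen_c # Gen_b # w) = - word_value p q (v @ Gen_b # Gen_c # w)"
  "g \<in> {Gen_a, Gen_d} \<and> h \<in> {Gen_b, Gen_c} \<or> h \<in> {Gen_a, Gen_d} \<and> g \<in> {Gen_b, Gen_c} \<Longrightarrow>
    word_value p q (v @ g # h # w) = 0"
  by (auto simp: word_value_def word_sign_swap)

lemma word_value_ideal:
  assumes "x \<in> S14_ideal"
  shows "extend_linearly (\<lambda>w. word_value p q (letters w)) x = 0" (is "?f x = 0")
  using clinear_extend_linearly _ assms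
proof (rule clinear_zero_on_span)
  note [simp] = extend_linearly_simps
  fix x assume "x \<in> {s * r * t | s r t. r \<in> S14_relators}"
  then obtain s r t where x: "x = s * r * t" and r: "r \<in> S14_relators" by blast
  have "?f (s * r * t) = 0"
  proof (induction s rule: poly_mapping_induct_single)
    case (single v c)
    show ?case
    proof (induction t rule: poly_mapping_induct_single)
      case (single w d)
      show ?case using r unfolding S14_relators_def Let_def
        by (elim insertE emptyE)
          (simp_all add: distrib_left distrib_right mult_single plus_gen_word_def
            word_value_relations)
    qed (simp add: distrib_left)
  qed (simp add: distrib_right)
  then show "?f x = 0" by (simp add: x)
qed

lemma word_value_basis:
  "word_value p q (replicate k Gen_a @ replicate l Gen_d) = p k l"
  "p 0 0 = q 0 0 \<Longrightarrow> word_value p q (replicate k Gen_b @ replicate l Gen_c) = q k l"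
proof -
  have d: "count_list (replicate n g) h = (if g = h then n else 0)" for n and g h :: gen
    by (induction n) auto
  have s: "word_sign (replicate l Gen_d) = 1" "word_sign (replicate l Gen_c) = 1" for l
    by (induction l) (auto simp: d)
  have "word_sign (replicate k Gen_a @ replicate l Gen_d) = 1"
    "word_sign (replicate k Gen_b @ replicate l Gen_c) = 1" by (induction k) (auto simp: s)
  then show "word_value p q (replicate k Gen_a @ replicate l Gen_d) = p k l"
    "p 0 0 = q 0 0 \<Longrightarrow> word_value p q (replicate k Gen_b @ replicate l Gen_c) = q k l"
    by (auto simp: word_value_def d set_replicate_conv_if)
qed

lemma S14_power_swap:
  "S14_d * S14_a ^ k = (- 1) ^ k *\<^sub>C (S14_a ^ k * S14_d)"
  "S14_c * S14_b ^ k = (- 1) ^ k *\<^sub>C (S14_b ^ k * S14_c)"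
proof -
  have *: "y * x ^ k = (- 1) ^ k *\<^sub>C (x ^ k * y)" if "y * x = - (x * y)" for x y :: S14
  proof (induction k)
    case (Suc k)
    have "y * x ^ Suc k = - (x * (y * x ^ k))" by (simp add: that flip: mult.assoc)
    then show ?case using Suc by (simp add: mult_scaleC_right mult.assoc)
  qed (simp add: scaleC_one)
  show "S14_d * S14_a ^ k = (- 1) ^ k *\<^sub>C (S14_a ^ k * S14_d)"
    "S14_c * S14_b ^ k = (- 1) ^ k *\<^sub>C (S14_b ^ k * S14_c)" by (intro * S14_relations)+
qed

lemma S14_word_normal_form:
  "\<exists>e k l. prod_list (map S14_gen gs) = e *\<^sub>C (S14_a ^ k * S14_d ^ l) \<or>
    prod_list (map S14_gen gs) = e *\<^sub>C (S14_b ^ k * S14_c ^ l)"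
proof (induction gs)
  case Nil
  show ?case by (rule exI[of _ 1], rule exI[of _ 0], rule exI[of _ 0]) (simp add: scaleC_one)
next
  case (Cons g gs)
  have swap: "S14_d * (S14_a ^ k * S14_d ^ l) = (- 1) ^ k *\<^sub>C (S14_a ^ k * S14_d ^ Suc l)"
    "S14_c * (S14_b ^ k * S14_c ^ l) = (- 1) ^ k *\<^sub>C (S14_b ^ k * S14_c ^ Suc l)" for k l
    by (simp_all add: S14_power_swap mult_scaleC_left flip: mult.assoc)
  let ?N = "\<lambda>x. \<exists>e k l. x = e *\<^sub>C (S14_a ^ k * S14_d ^ l) \<or> x = e *\<^sub>C (S14_b ^ k * S14_c ^ l)"
  have N: "?N (e *\<^sub>C (S14_a ^ k * S14_d ^ l))" "?N (e *\<^sub>C (S14_b ^ k * S14_c ^ l))" for e k l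
    by blast+
  have N0: "?N 0" using N(1)[of 0 0 0] by simp
  have gen: "?N (e *\<^sub>C S14_gen g)" for e
    using N(1)[of e 1 0] N(1)[of e 0 1] N(2)[of e 1 0] N(2)[of e 0 1] by (cases g) simp_all
  have ad: "?N (S14_gen g * e *\<^sub>C (S14_a ^ k * S14_d ^ l))" for e k l
  proof -
    have "S14_gen g * (S14_a ^ k * S14_d ^ l) =
      (case g of Gen_a \<Rightarrow> S14_a ^ Suc k * S14_d ^ l
        | Gen_d \<Rightarrow> (- 1) ^ k *\<^sub>C (S14_a ^ k * S14_d ^ Suc l)
        | _ \<Rightarrow> if k = 0 \<and> l = 0 then S14_gen g else 0)"
    proof (cases g)
      case Gen_d
      then show ?thesis by (simp add: swap)
    qed (cases k; cases l; simp flip: mult.assoc)+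
    then show ?thesis using N(1)[of e "Suc k" l] N(1)[of "e * (- 1) ^ k" k "Suc l"] gen[of e] N0
      by (cases g) (auto simp: mult_scaleC_right simp del: power_Suc)
  qed
  have bc: "?N (S14_gen g * e *\<^sub>C (S14_b ^ k * S14_c ^ l))" for e k l
  proof -
    have "S14_gen g * (S14_b ^ k * S14_c ^ l) =
      (case g of Gen_b \<Rightarrow> S14_b ^ Suc k * S14_c ^ l
        | Gen_c \<Rightarrow> (- 1) ^ k *\<^sub>C (S14_b ^ k * S14_c ^ Suc l)
        | _ \<Rightarrow> if k = 0 \<and> l = 0 then S14_gen g else 0)"
    proof (cases g)
      case Gen_c
      then show ?thesis by (simp add: swap)
    qed (cases k; cases l; simp flip: mult.assoc)+
    then show ?thesis using N(2)[of e "Suc k" l] N(2)[of "e * (- 1) ^ k" k "Suc l"] gen[of e] N0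
      by (cases g) (auto simp: mult_scaleC_right simp del: power_Suc)
  qed
  have eq: "prod_list (map S14_gen (g # gs)) = S14_gen g * prod_list (map S14_gen gs)" by simp
  from Cons obtain e k l where "prod_list (map S14_gen gs) = e *\<^sub>C (S14_a ^ k * S14_d ^ l) \<or>
    prod_list (map S14_gen gs) = e *\<^sub>C (S14_b ^ k * S14_c ^ l)" by blast
  then show ?case
  proof
    assume h: "prod_list (map S14_gen gs) = e *\<^sub>C (S14_a ^ k * S14_d ^ l)"
    show ?case unfolding eq h by (rule ad)
  next
    assume h: "prod_list (map S14_gen gs) = e *\<^sub>C (S14_b ^ k * S14_c ^ l)"
    show ?case unfolding eq h by (rule bc)
  qed
qed

(* Both families contain the unit, whence the hypothesis. *)
lemma functional_on_basis:
  assumes "p 0 0 = q 0 0"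
  shows "\<exists>!u. \<forall>k l. functional_apply u (S14_a ^ k * S14_d ^ l) = p k l \<and>
    functional_apply u (S14_b ^ k * S14_c ^ l) = q k l"
proof (rule ex_ex1I)
  let ?f = "extend_linearly (\<lambda>w. word_value p q (letters w))"
  define u where "u = Abs_S14_functional (\<lambda>x. ?f (rep_S14 x))"
  have abs: "?f (rep_S14 (abs_S14 x)) = ?f x" for x
  proof -
    have "rep_S14 (abs_S14 x) - x \<in> S14_ideal"
      by (rule Quotient3_rep_abs[OF Quotient3_S14]) (simp add: complex_vector.span_zero)
    from word_value_ideal[OF this] show ?thesis by (simp add: extend_linearly_simps)
  qed
  have ex: "\<exists>p. x = abs_S14 p" for x
    by (induction x rule: S14.abs_induct) blast
  have "clinear (\<lambda>x. ?f (rep_S14 x))"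
  proof (rule clinearI)
    fix x y c
    obtain x' y' where [simp]: "x = abs_S14 x'" "y = abs_S14 y'" using ex by blast
    show "?f (rep_S14 (x + y)) = ?f (rep_S14 x) + ?f (rep_S14 y)"
      "?f (rep_S14 (c *\<^sub>C x)) = c *\<^sub>C ?f (rep_S14 x)"
      by (simp_all add: plus_S14.abs_eq scaleC_S14.abs_eq abs extend_linearly_simps)
  qed
  then have u: "functional_apply u (abs_S14 x) = ?f x" for x
    by (simp add: u_def Abs_S14_functional_inverse abs)
  have "functional_apply u (prod_list (map S14_gen gs)) = word_value p q gs" for gs
    using u[of "Poly_Mapping.single (Word gs) 1"] by (simp add: S14_word scaleC_complex_def)
  moreover have "prod_list (map S14_gen (replicate k g @ replicate l h)) = S14_gen g ^ k * S14_gen h ^ l"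
    for k l g h by simp
  ultimately have "\<forall>k l. functional_apply u (S14_a ^ k * S14_d ^ l) = p k l \<and>
    functional_apply u (S14_b ^ k * S14_c ^ l) = q k l"
    by (metis word_value_basis assms)
  then show "\<exists>u. \<forall>k l. functional_apply u (S14_a ^ k * S14_d ^ l) = p k l \<and>
    functional_apply u (S14_b ^ k * S14_c ^ l) = q k l" by blast
next
  fix u v
  assume *: "\<forall>k l. functional_apply u (S14_a ^ k * S14_d ^ l) = p k l \<and>
      functional_apply u (S14_b ^ k * S14_c ^ l) = q k l"
    "\<forall>k l. functional_apply v (S14_a ^ k * S14_d ^ l) = p k l \<and>
      functional_apply v (S14_b ^ k * S14_c ^ l) = q k l"
  note [simp] = clinearD[OF clinear_functional_apply]
  have "functional_apply u x = functional_apply v x" for x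
  proof (induction x rule: S14_induct)
    case (word gs)
    from S14_word_normal_form[of gs] * show ?case by auto
  qed simp_all
  then show "u = v" by (simp add: functional_apply_inject[symmetric] fun_eq_iff)
qed

(* The functional with values p k l on a^k d^l and q k l on b^k c^l. *)
definition basis_functional :: "(nat \<Rightarrow> nat \<Rightarrow> complex) \<Rightarrow> (nat \<Rightarrow> nat \<Rightarrow> complex) \<Rightarrow> S14_functional"
  where "basis_functional p q =
    (THE u. \<forall>k l. functional_apply u (S14_a ^ k * S14_d ^ l) = p k l \<and>
      functional_apply u (S14_b ^ k * S14_c ^ l) = q k l)"

lemma basis_functional:
  assumes "p 0 0 = q 0 0"
  shows "functional_apply (basis_functional p q) (S14_a ^ k * S14_d ^ l) = p k l"
    and "functional_apply (basis_functional p q) (S14_b ^ k * S14_c ^ l) = q k l"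
  using theI'[OF functional_on_basis[of p q, OF assms]] unfolding basis_functional_def by blast+

definition functional_A :: S14_functional
  where "functional_A = basis_functional (\<lambda>k l. if l = 0 then of_nat k else 0) (\<lambda>k l. 0)"

definition functional_B :: S14_functional
  where "functional_B = basis_functional (\<lambda>k l. 0) (\<lambda>k l. if k = 1 \<and> l = 0 then 1 else 0)"

definition functional_C :: S14_functional
  where "functional_C = basis_functional (\<lambda>k l. 0) (\<lambda>k l. if k = 0 \<and> l = 1 then 1 else 0)"

definition functional_D :: S14_functional
  where "functional_D = basis_functional (\<lambda>k l. if l = 1 then 1 else 0) (\<lambda>k l. 0)"

definition functional_E :: S14_functional
  where "functional_E = basis_functional
    (\<lambda>k l. if k = 0 \<and> l = 0 then 1 else 0) (\<lambda>k l. if k = 0 \<and> l = 0 then 1 else 0)"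

definition functional_K :: S14_functional
  where "functional_K = basis_functional
    (\<lambda>k l. if l = 0 then (- 1) ^ k else 0) (\<lambda>k l. if k = 0 \<and> l = 0 then 1 else 0)"


section \<open>The dual bialgebra s14\<close>

typedef s14 = "generated_subalgebra
    {functional_A, functional_B, functional_C, functional_D, functional_E, functional_K}"
  morphisms functional_of Abs_s14
  by (rule exI) (rule generated_subalgebra.one)

setup_lifting type_definition_s14

lemma generated_subalgebra_zero: "0 \<in> generated_subalgebra G"
  using generated_subalgebra.scale[OF generated_subalgebra.one, of 0 G] by simp

lemma generated_subalgebra_uminus:
  "x \<in> generated_subalgebra G \<Longrightarrow> - x \<in> generated_subalgebra G"
  using generated_subalgebra.scale[of x G "- 1"] by (simp add: scaleC_one)

lemma generated_subalgebra_diff: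
  "x \<in> generated_subalgebra G \<Longrightarrow> y \<in> generated_subalgebra G \<Longrightarrow> x - y \<in> generated_subalgebra G"
  using generated_subalgebra.add[of x G "- y"] generated_subalgebra_uminus[of y G] by simp

instantiation s14 :: complex_algebra
begin
lift_definition zero_s14 :: s14 is 0 by (rule generated_subalgebra_zero)
lift_definition one_s14 :: s14 is 1 by (rule generated_subalgebra.one)
lift_definition plus_s14 :: "s14 \<Rightarrow> s14 \<Rightarrow> s14" is "(+)" by (rule generated_subalgebra.add)
lift_definition minus_s14 :: "s14 \<Rightarrow> s14 \<Rightarrow> s14" is "(-)" by (rule generated_subalgebra_diff)
lift_definition uminus_s14 :: "s14 \<Rightarrow> s14" is uminus by (rule generated_subalgebra_uminus)
lift_definition times_s14 :: "s14 \<Rightarrow> s14 \<Rightarrow> s14" is "(*)" by (rule generated_subalgebra.mult)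
lift_definition scaleC_s14 :: "complex \<Rightarrow> s14 \<Rightarrow> s14" is scaleC by (rule generated_subalgebra.scale)
instance
  by (standard; transfer)
    (simp_all add: algebra_simps scaleC_add_left scaleC_add_right scaleC_one mult_scaleC_left
      mult_scaleC_right)
end

lift_definition s14_A :: s14 is functional_A by (rule generated_subalgebra.gen) simp
lift_definition s14_B :: s14 is functional_B by (rule generated_subalgebra.gen) simp
lift_definition s14_C :: s14 is functional_C by (rule generated_subalgebra.gen) simp
lift_definition s14_D :: s14 is functional_D by (rule generated_subalgebra.gen) simp
lift_definition s14_E :: s14 is functional_E by (rule generated_subalgebra.gen) simp
lift_definition s14_K :: s14 is functional_K by (rule generated_subalgebra.gen) simp

definition s14_pairing :: "s14 \<Rightarrow> S14 \<Rightarrow> complex" (\<open>\<langle>_, _\<rangle>\<close>)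
  where "\<langle>u, f\<rangle> = functional_apply (functional_of u) f"

(* The pairing of tensors determined by \<langle>u \<otimes> v, f \<otimes> g\<rangle> = \<langle>u, f\<rangle> * \<langle>v, g\<rangle>. *)
definition tensor_pairing :: "(s14, s14) tensor \<Rightarrow> (S14, S14) tensor \<Rightarrow> complex"
  where "tensor_pairing t s = tensor_lift (\<lambda>u v. tensor_lift (\<lambda>f g. \<langle>u, f\<rangle> * \<langle>v, g\<rangle>) s) t"

(* There is at most one such t: s14 consists of functionals on S14, so an element of
   s14 \<otimes> s14 that pairs to 0 with every f \<otimes> g is 0. *)
definition s14_comult :: "s14 \<Rightarrow> (s14, s14) tensor"
  where "s14_comult u = (THE t. \<forall>f g. tensor_pairing t (f \<otimes> g) = \<langle>u, f * g\<rangle>)"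

definition s14_counit :: "s14 \<Rightarrow> complex"
  where "s14_counit u = \<langle>u, 1\<rangle>"

end

(* The multiplication of S14 dualizes to the relation is_comult u t, meaning <t, f (x) g> = <u, f g>.
   It is compatible with sums and products, and t is unique because a tensor over linearly
   independent functionals vanishes once it pairs to 0 with every f (x) g; so it suffices to find
   coproducts of the generators. An element with coproduct u (x) p + q (x) u is determined
   by its values on 1, a, b, c, d, which reduces every relation to a finite check. *)
theory Submission
  imports Defs
begin

section \<open>The pairing of s14 with S14, and induction over the generators of s14\<close>

lemma s14_pairing_linear [simp]:
  "\<langle>u, f + g\<rangle> = \<langle>u, f\<rangle> + \<langle>u, g\<rangle>" "\<langle>u, f - g\<rangle> = \<langle>u, f\<rangle> - \<langle>u, g\<rangle>"
  "\<langle>u, - f\<rangle> = - \<langle>u, f\<rangle>" "\<langle>u, 0\<rangle> = 0" "\<langle>u, c *\<^sub>C f\<rangle> = c * \<langle>u, f\<rangle>"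
  "\<langle>u + v, f\<rangle> = \<langle>u, f\<rangle> + \<langle>v, f\<rangle>" "\<langle>u - v, f\<rangle> = \<langle>u, f\<rangle> - \<langle>v, f\<rangle>"
  "\<langle>- u, f\<rangle> = - \<langle>u, f\<rangle>" "\<langle>0, f\<rangle> = 0" "\<langle>c *\<^sub>C u, f\<rangle> = c * \<langle>u, f\<rangle>"
  "\<langle>1, f\<rangle> = S14_counit f"
  by (simp_all add: s14_pairing_def clinearD[OF clinear_functional_apply] scaleC_complex_def
      plus_s14.rep_eq minus_s14.rep_eq uminus_s14.rep_eq zero_s14.rep_eq scaleC_s14.rep_eq
      one_s14.rep_eq plus_S14_functional.rep_eq minus_S14_functional.rep_eq
      uminus_S14_functional.rep_eq zero_S14_functional.rep_eq scaleC_S14_functional.rep_eq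
      one_S14_functional.rep_eq)

lemma clinear_s14_pairing: "clinear (\<lambda>f. \<langle>u, f\<rangle>)" "clinear (\<lambda>u. \<langle>u, f\<rangle>)"
  by (intro clinearI; simp add: scaleC_complex_def)+

lemma cbilinear_pairing_mult:
  "cbilinear (\<lambda>f g. \<langle>u, f\<rangle> * \<langle>v, g\<rangle>)" "cbilinear (\<lambda>u v. \<langle>u, f\<rangle> * \<langle>v, g\<rangle>)"
  by (intro cbilinearI; simp add: scaleC_complex_def algebra_simps)+

lemmas pairing_lift [simp] =
  tensor_lift_tensor[OF cbilinear_pairing_mult(1)] tensor_lift_simps[OF cbilinear_pairing_mult(1)]

lemma s14_eqI: "(\<And>f. \<langle>u, f\<rangle> = \<langle>v, f\<rangle>) \<Longrightarrow> u = v"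
  by (metis ext functional_apply_inject functional_of_inject s14_pairing_def)

lemma s14_pairing_mult:
  "\<langle>u * v, f\<rangle> = tensor_lift (\<lambda>x y. \<langle>u, x\<rangle> * \<langle>v, y\<rangle>) (S14_comult f)"
  by (simp add: s14_pairing_def times_s14.rep_eq times_S14_functional.rep_eq)

lemma s14_pairing_mult_gen [simp]:
  "\<langle>u * v, 1\<rangle> = \<langle>u, 1\<rangle> * \<langle>v, 1\<rangle>"
  "\<langle>u * v, S14_a\<rangle> = \<langle>u, S14_a\<rangle> * \<langle>v, S14_a\<rangle> + \<langle>u, S14_b\<rangle> * \<langle>v, S14_b\<rangle>
    - \<langle>u, S14_c\<rangle> * \<langle>v, S14_c\<rangle> + \<langle>u, S14_d\<rangle> * \<langle>v, S14_d\<rangle>"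
  "\<langle>u * v, S14_b\<rangle> = \<langle>u, S14_a\<rangle> * \<langle>v, S14_b\<rangle> + \<langle>u, S14_b\<rangle> * \<langle>v, S14_a\<rangle>
    - \<langle>u, S14_c\<rangle> * \<langle>v, S14_d\<rangle> + \<langle>u, S14_d\<rangle> * \<langle>v, S14_c\<rangle>"
  "\<langle>u * v, S14_c\<rangle> = \<langle>u, S14_a\<rangle> * \<langle>v, S14_c\<rangle> + \<langle>u, S14_c\<rangle> * \<langle>v, S14_a\<rangle>
    - \<langle>u, S14_b\<rangle> * \<langle>v, S14_d\<rangle> + \<langle>u, S14_d\<rangle> * \<langle>v, S14_b\<rangle>"
  "\<langle>u * v, S14_d\<rangle> = \<langle>u, S14_a\<rangle> * \<langle>v, S14_d\<rangle> + \<langle>u, S14_d\<rangle> * \<langle>v, S14_a\<rangle>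
    - \<langle>u, S14_b\<rangle> * \<langle>v, S14_c\<rangle> + \<langle>u, S14_c\<rangle> * \<langle>v, S14_b\<rangle>"
  by (simp_all add: s14_pairing_mult S14_comult(2-) algebra_homD[OF S14_comult(1)] one_tensor_def)

lemma s14_induct [case_names gen one add scale mult]:
  assumes "\<And>u. u \<in> {s14_A, s14_B, s14_C, s14_D, s14_E, s14_K} \<Longrightarrow> P u" "P 1"
    "\<And>u v. P u \<Longrightarrow> P v \<Longrightarrow> P (u + v)" "\<And>c u. P u \<Longrightarrow> P (c *\<^sub>C u)"
    "\<And>u v. P u \<Longrightarrow> P v \<Longrightarrow> P (u * v)"
  shows "P u"
proof -
  \<comment> \<open>\<open>P\<close> speaks of s14 while the rule induction runs over functionals,
    so each functional carries a preimage in s14 along.\<close>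
  have "\<exists>u. x = functional_of u \<and> P u" if "x \<in> generated_subalgebra
    {functional_A, functional_B, functional_C, functional_D, functional_E, functional_K}" for x
    using that
  proof (induction rule: generated_subalgebra.induct)
    case (gen x)
    then show ?case
      using assms(1) by (auto simp flip: s14_A.rep_eq s14_B.rep_eq s14_C.rep_eq s14_D.rep_eq
          s14_E.rep_eq s14_K.rep_eq)
  next
    case one
    show ?case using assms(2) by (intro exI[of _ 1]) (simp add: one_s14.rep_eq)
  next
    case (add x y)
    then show ?case using assms(3) by (auto simp flip: plus_s14.rep_eq)
  next
    case (scale x c)
    then show ?case using assms(4) by (auto simp flip: scaleC_s14.rep_eq)
  next
    case (mult x y)
    then show ?case using assms(5) by (auto simp flip: times_s14.rep_eq)
  qed
  from this[OF functional_of[of u]] show ?thesis by (simp add: functional_of_inject)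
qed

lemma s14_hom_eqI:
  assumes f: "algebra_hom f" and g: "algebra_hom g"
    and "\<And>u. u \<in> {s14_A, s14_B, s14_C, s14_D, s14_E, s14_K} \<Longrightarrow> f u = g u"
  shows "f u = g u"
  by (induction u rule: s14_induct)
    (use assms(3) in \<open>simp_all add: algebra_homD[OF f] algebra_homD[OF g]
      clinearD[OF algebra_homD(1)[OF f]] clinearD[OF algebra_homD(1)[OF g]]\<close>)

text \<open>The centralizer of an element is a unital subalgebra, so it is everything once it
  contains the generators.\<close>

lemma s14_central:
  assumes "\<And>u. u \<in> {s14_A, s14_B, s14_C, s14_D, s14_E, s14_K} \<Longrightarrow> z * u = u * z"
  shows "z * u = u * z"
proof (induction u rule: s14_induct)
  case (mult u v)
  then show ?case by (metis mult.assoc)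
qed (use assms in \<open>simp_all add: distrib_left distrib_right mult_scaleC_left mult_scaleC_right\<close>)


section \<open>The coproduct dual to the multiplication\<close>

text \<open>A relation, because the definite description in \<open>s14_comult\<close> yields nothing
  before existence and uniqueness are known.\<close>

definition is_comult :: "s14 \<Rightarrow> (s14, s14) tensor \<Rightarrow> bool"
  where "is_comult u t \<longleftrightarrow> (\<forall>f g. tensor_pairing t (f \<otimes> g) = \<langle>u, f * g\<rangle>)"

lemma tensor_pairing_tensor_right:
  "tensor_pairing t (f \<otimes> g) = tensor_lift (\<lambda>u v. \<langle>u, f\<rangle> * \<langle>v, g\<rangle>) t"
  by (simp add: tensor_pairing_def)

lemma tensor_pairing_simps [simp]:
  "tensor_pairing (u \<otimes> v) (f \<otimes> g) = \<langle>u, f\<rangle> * \<langle>v, g\<rangle>"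
  "tensor_pairing (s + t) (f \<otimes> g) = tensor_pairing s (f \<otimes> g) + tensor_pairing t (f \<otimes> g)"
  "tensor_pairing (s - t) (f \<otimes> g) = tensor_pairing s (f \<otimes> g) - tensor_pairing t (f \<otimes> g)"
  "tensor_pairing (c *\<^sub>C t) (f \<otimes> g) = c * tensor_pairing t (f \<otimes> g)"
  "tensor_pairing (sum h A) (f \<otimes> g) = (\<Sum>k\<in>A. tensor_pairing (h k) (f \<otimes> g))"
  by (simp_all add: tensor_pairing_tensor_right tensor_lift_tensor[OF cbilinear_pairing_mult(2)]
      tensor_lift_simps[OF cbilinear_pairing_mult(2)] scaleC_complex_def)

text \<open>Expanding left factors in \<open>B\<close> and collecting by bilinearity makes each
  vector of \<open>B\<close> occur at most once on the left, the form to which linear independence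
  applies.\<close>

lemma tensor_basis_expansion:
  fixes t :: "('a::complex_vector, 'b::complex_vector) tensor"
  assumes "complex_vector.span B = (UNIV :: 'a set)"
  shows "\<exists>S h. finite S \<and> S \<subseteq> B \<and> t = (\<Sum>x\<in>S. x \<otimes> h x)"
proof (induction t rule: tensor_induct)
  case (tensor x y)
  from assms have "x \<in> complex_vector.span B" by simp
  then obtain S r where S: "finite S" "S \<subseteq> B" "x = (\<Sum>b\<in>S. r b *\<^sub>C b)"
    by (auto simp: complex_vector.span_explicit)
  have lin: "clinear (\<lambda>x. x \<otimes> y)"
    using cbilinear_tensor by (auto simp: cbilinear_def)
  have "x \<otimes> y = (\<Sum>b\<in>S. b \<otimes> r b *\<^sub>C y)"
    unfolding S(3) by (simp only: clinearD(6)[OF lin] tensor_simps)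
  then show ?case using S by (intro exI[of _ S] exI[of _ "\<lambda>b. r b *\<^sub>C y"]) auto
next
  case (add s t)
  then obtain S h T k where S: "finite S" "S \<subseteq> B" "s = (\<Sum>x\<in>S. x \<otimes> h x)"
    and T: "finite T" "T \<subseteq> B" "t = (\<Sum>x\<in>T. x \<otimes> k x)" by blast
  \<comment> \<open>Extension by 0 lets both sums run over the common index set
    \<open>S \<union> T\<close>.\<close>
  let ?h = "\<lambda>x. if x \<in> S then h x else 0" and ?k = "\<lambda>x. if x \<in> T then k x else 0"
  have "s = (\<Sum>x\<in>S \<union> T. x \<otimes> ?h x)" "t = (\<Sum>x\<in>S \<union> T. x \<otimes> ?k x)"
    unfolding S(3) T(3) using S(1) T(1)
    by (intro sum.mono_neutral_cong_left; auto simp: tensor_more_simps)+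
  then have "s + t = (\<Sum>x\<in>S \<union> T. x \<otimes> (?h x + ?k x))"
    by (simp only: tensor_add_right sum.distrib)
  then show ?case using S T
    by (intro exI[of _ "S \<union> T"] exI[of _ "\<lambda>x. ?h x + ?k x"]) auto
qed

text \<open>Write t as a sum of y \<otimes> h y over independent y. For fixed g the combination of
  the y with coefficients <h y, g> pairs to 0 with every f, so it is 0 and each <h y, g> vanishes.
  As g is arbitrary, each h y is 0.\<close>

lemma tensor_pairing_nondegenerate:
  assumes "\<And>f g. tensor_pairing t (f \<otimes> g) = 0"
  shows "t = 0"
proof -
  \<comment> \<open>Extending the empty independent set gives a Hamel basis of s14.\<close>
  let ?B = "complex_vector.extend_basis ({} :: s14 set)"
  have B: "complex_vector.independent ?B" "complex_vector.span ?B = UNIV"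
    by (simp_all add: complex_vector.independent_extend_basis complex_vector.independent_empty)
  obtain S h where S: "finite S" "S \<subseteq> ?B" "t = (\<Sum>x\<in>S. x \<otimes> h x)"
    using tensor_basis_expansion[OF B(2)] by blast
  have "h x = 0" if "x \<in> S" for x
  proof (rule s14_eqI)
    fix g
    have "(\<Sum>y\<in>S. \<langle>h y, g\<rangle> *\<^sub>C y) = 0"
    proof (rule s14_eqI)
      fix f
      show "\<langle>\<Sum>y\<in>S. \<langle>h y, g\<rangle> *\<^sub>C y, f\<rangle> = \<langle>0, f\<rangle>"
        using assms[of f g] by (simp add: S(3) clinearD(6)[OF clinear_s14_pairing(2)] mult.commute)
    qed
    then have "\<langle>h x, g\<rangle> = 0"
      using complex_vector.independentD[OF B(1) S(1,2), of "\<lambda>y. \<langle>h y, g\<rangle>"] that by blast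
    then show "\<langle>h x, g\<rangle> = \<langle>0, g\<rangle>" by simp
  qed
  then show ?thesis by (simp add: S(3) tensor_more_simps)
qed

text \<open>In Sweedler notation, <s t, f \<otimes> g> is the sum of <s, f1 \<otimes> g1> <t, f2
  \<otimes> g2>: the product on s14 \<otimes> s14 is dual to the coproduct of S14 in each
  leg.\<close>

lemma tensor_pairing_mult:
  "tensor_pairing (s * t) (f \<otimes> g) =
    tensor_lift (\<lambda>x y. tensor_lift (\<lambda>x' y'. tensor_pairing s (x \<otimes> x') * tensor_pairing t (y \<otimes> y'))
      (S14_comult g)) (S14_comult f)"
proof (induction s rule: tensor_induct)
  case (tensor u v)
  show ?case
  proof (induction t rule: tensor_induct)
    case (tensor u' v')
    have *: "tensor_lift (\<lambda>x y. c * B x y) t = c * tensor_lift B t"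
      for c and B :: "S14 \<Rightarrow> S14 \<Rightarrow> complex" and t
      using tensor_lift_scale[of c B t] by (simp add: scaleC_complex_def)
    \<comment> \<open>Regrouping separates the factors coming from f and from g, so that the sum
      over the coproduct of g comes out as the constant \<open>L\<close>.\<close>
    have eq: "(\<lambda>x' y'. \<langle>u, x\<rangle> * \<langle>v, x'\<rangle> * (\<langle>u', y\<rangle> * \<langle>v', y'\<rangle>)) =
        (\<lambda>x' y'. (\<langle>u, x\<rangle> * \<langle>u', y\<rangle>) * (\<langle>v, x'\<rangle> * \<langle>v', y'\<rangle>))" for x y
      by (simp add: fun_eq_iff mult_ac)
    define L where "L = tensor_lift (\<lambda>x y. \<langle>v, x\<rangle> * \<langle>v', y\<rangle>) (S14_comult g)"
    have "tensor_lift (\<lambda>x' y'. \<langle>u, x\<rangle> * \<langle>v, x'\<rangle> * (\<langle>u', y\<rangle> * \<langle>v', y'\<rangle>)) (S14_comult g) =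
        L * (\<langle>u, x\<rangle> * \<langle>u', y\<rangle>)" for x y
      unfolding eq * L_def by (rule mult.commute)
    then have "tensor_lift (\<lambda>x y. tensor_lift (\<lambda>x' y'. \<langle>u, x\<rangle> * \<langle>v, x'\<rangle> * (\<langle>u', y\<rangle> * \<langle>v', y'\<rangle>))
        (S14_comult g)) (S14_comult f) = tensor_lift (\<lambda>x y. L * (\<langle>u, x\<rangle> * \<langle>u', y\<rangle>)) (S14_comult f)"
      by simp
    also have "\<dots> = L * tensor_lift (\<lambda>x y. \<langle>u, x\<rangle> * \<langle>u', y\<rangle>) (S14_comult f)"
      by (rule *)
    finally show ?case
      by (simp add: tensor_mult_tensor s14_pairing_mult mult.commute[of _ L] flip: L_def)
  qed (simp add: distrib_left tensor_lift_add)
qed (simp add: distrib_right tensor_lift_add)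

text \<open>The coproduct of S14 is multiplicative, so <u v, f g> is the sum of <u, f1 g1> <v, f2
  g2>. The hypotheses turn this into the sum of <s, f1 \<otimes> g1> <t, f2 \<otimes> g2>, the
  pairing of \<open>s * t\<close>.\<close>

lemma is_comult_mult:
  assumes "is_comult u s" "is_comult v t"
  shows "is_comult (u * v) (s * t)"
  unfolding is_comult_def
proof (intro allI)
  fix f g
  have bil: "cbilinear (\<lambda>x' y'. \<langle>u, x * x'\<rangle> * \<langle>v, y * y'\<rangle>)" for x y
    by (intro cbilinearI)
      (simp_all add: distrib_left mult_scaleC_right scaleC_complex_def algebra_simps)
  have bil2: "cbilinear (\<lambda>x y. tensor_lift (\<lambda>x' y'. \<langle>u, x * x'\<rangle> * \<langle>v, y * y'\<rangle>) G)" for G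
    by (intro cbilinearI)
      (simp_all add: distrib_right mult_scaleC_left
        flip: tensor_lift_add tensor_lift_scale, simp_all add: scaleC_complex_def algebra_simps)
  have "tensor_lift (\<lambda>x y. \<langle>u, x\<rangle> * \<langle>v, y\<rangle>) (F * G) =
      tensor_lift (\<lambda>x y. tensor_lift (\<lambda>x' y'. \<langle>u, x * x'\<rangle> * \<langle>v, y * y'\<rangle>) G) F" for F G
  proof (induction F rule: tensor_induct)
    case (tensor x y)
    show ?case unfolding tensor_lift_tensor[OF bil2]
      by (induction G rule: tensor_induct)
        (simp_all add: tensor_mult_tensor tensor_lift_tensor[OF bil]
          tensor_lift_simps[OF bil] distrib_left)
  qed (simp add: distrib_right tensor_lift_simps[OF bil2])
  then show "tensor_pairing (s * t) (f \<otimes> g) = \<langle>u * v, f * g\<rangle>"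
    using assms by (simp add: is_comult_def tensor_pairing_mult s14_pairing_mult
        algebra_homD(3)[OF S14_comult(1)])
qed


section \<open>The generators on products\<close>

text \<open>Up to sign, left multiplication by a generator sends a basis element to a basis element
  or 0. The sign comes from moving d past the a's, or c past the b's.\<close>

lemma S14_gen_mult_basis:
  "S14_gen g * (S14_a ^ k * S14_d ^ l) =
    (case g of Gen_a \<Rightarrow> S14_a ^ Suc k * S14_d ^ l
      | Gen_d \<Rightarrow> (- 1) ^ k *\<^sub>C (S14_a ^ k * S14_d ^ Suc l)
      | _ \<Rightarrow> if k = 0 \<and> l = 0 then S14_gen g else 0)"
  "S14_gen g * (S14_b ^ k * S14_c ^ l) =
    (case g of Gen_b \<Rightarrow> S14_b ^ Suc k * S14_c ^ l
      | Gen_c \<Rightarrow> (- 1) ^ k *\<^sub>C (S14_b ^ k * S14_c ^ Suc l)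
      | _ \<Rightarrow> if k = 0 \<and> l = 0 then S14_gen g else 0)"
proof -
  have swap: "S14_d * (S14_a ^ k * S14_d ^ l) = (- 1) ^ k *\<^sub>C (S14_a ^ k * S14_d ^ Suc l)"
    "S14_c * (S14_b ^ k * S14_c ^ l) = (- 1) ^ k *\<^sub>C (S14_b ^ k * S14_c ^ Suc l)" for k l
    by (simp_all add: S14_power_swap mult_scaleC_left flip: mult.assoc)
  show "S14_gen g * (S14_a ^ k * S14_d ^ l) =
    (case g of Gen_a \<Rightarrow> S14_a ^ Suc k * S14_d ^ l
      | Gen_d \<Rightarrow> (- 1) ^ k *\<^sub>C (S14_a ^ k * S14_d ^ Suc l)
      | _ \<Rightarrow> if k = 0 \<and> l = 0 then S14_gen g else 0)"
  proof (cases g)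
    case Gen_d
    then show ?thesis by (simp add: swap)
  qed (cases k; cases l; simp flip: mult.assoc)+
  show "S14_gen g * (S14_b ^ k * S14_c ^ l) =
    (case g of Gen_b \<Rightarrow> S14_b ^ Suc k * S14_c ^ l
      | Gen_c \<Rightarrow> (- 1) ^ k *\<^sub>C (S14_b ^ k * S14_c ^ Suc l)
      | _ \<Rightarrow> if k = 0 \<and> l = 0 then S14_gen g else 0)"
  proof (cases g)
    case Gen_c
    then show ?thesis by (simp add: swap)
  qed (cases k; cases l; simp flip: mult.assoc)+
qed

lemma S14_basis_induct [case_names ad bc add scale]:
  assumes "\<And>k l. P (S14_a ^ k * S14_d ^ l)" "\<And>k l. P (S14_b ^ k * S14_c ^ l)"
    "\<And>x y. P x \<Longrightarrow> P y \<Longrightarrow> P (x + y)" "\<And>c x. P x \<Longrightarrow> P (c *\<^sub>C x)"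
  shows "P x"
proof (induction x rule: S14_induct)
  case (word gs)
  show ?case using S14_word_normal_form[of gs] assms by metis
qed (use assms in auto)

lemma S14_counit_basis:
  "S14_counit (S14_a ^ k * S14_d ^ l) = (if l = 0 then 1 else 0)"
  "S14_counit (S14_b ^ k * S14_c ^ l) = (if k = 0 \<and> l = 0 then 1 else 0)"
proof -
  have "S14_counit (x ^ n) = S14_counit x ^ n" for x n
    by (induction n) (simp_all add: algebra_homD[OF S14_counit(1)])
  then show "S14_counit (S14_a ^ k * S14_d ^ l) = (if l = 0 then 1 else 0)"
    "S14_counit (S14_b ^ k * S14_c ^ l) = (if k = 0 \<and> l = 0 then 1 else 0)"
    by (simp_all add: algebra_homD[OF S14_counit(1)] S14_counit(2) power_0_left)
qed

lemma s14_pairing_basis: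
  "\<langle>s14_A, S14_a ^ k * S14_d ^ l\<rangle> = (if l = 0 then of_nat k else 0)"
  "\<langle>s14_A, S14_b ^ k * S14_c ^ l\<rangle> = 0"
  "\<langle>s14_B, S14_a ^ k * S14_d ^ l\<rangle> = 0"
  "\<langle>s14_B, S14_b ^ k * S14_c ^ l\<rangle> = (if k = 1 \<and> l = 0 then 1 else 0)"
  "\<langle>s14_C, S14_a ^ k * S14_d ^ l\<rangle> = 0"
  "\<langle>s14_C, S14_b ^ k * S14_c ^ l\<rangle> = (if k = 0 \<and> l = 1 then 1 else 0)"
  "\<langle>s14_D, S14_a ^ k * S14_d ^ l\<rangle> = (if l = 1 then 1 else 0)"
  "\<langle>s14_D, S14_b ^ k * S14_c ^ l\<rangle> = 0"
  "\<langle>s14_E, S14_a ^ k * S14_d ^ l\<rangle> = (if k = 0 \<and> l = 0 then 1 else 0)"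
  "\<langle>s14_E, S14_b ^ k * S14_c ^ l\<rangle> = (if k = 0 \<and> l = 0 then 1 else 0)"
  "\<langle>s14_K, S14_a ^ k * S14_d ^ l\<rangle> = (if l = 0 then (- 1) ^ k else 0)"
  "\<langle>s14_K, S14_b ^ k * S14_c ^ l\<rangle> = (if k = 0 \<and> l = 0 then 1 else 0)"
  unfolding s14_pairing_def s14_A.rep_eq s14_B.rep_eq s14_C.rep_eq s14_D.rep_eq s14_E.rep_eq
    s14_K.rep_eq functional_A_def functional_B_def functional_C_def functional_D_def
    functional_E_def functional_K_def
  by (subst basis_functional; simp)+

lemma s14_pairing_gen [simp]:
  "\<langle>s14_A, S14_gen g\<rangle> = (if g = Gen_a then 1 else 0)"
  "\<langle>s14_B, S14_gen g\<rangle> = (if g = Gen_b then 1 else 0)"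
  "\<langle>s14_C, S14_gen g\<rangle> = (if g = Gen_c then 1 else 0)"
  "\<langle>s14_D, S14_gen g\<rangle> = (if g = Gen_d then 1 else 0)"
  "\<langle>s14_E, S14_gen g\<rangle> = 0"
  "\<langle>s14_K, S14_gen g\<rangle> = (if g = Gen_a then - 1 else 0)"
  using s14_pairing_basis[of 1 0] s14_pairing_basis[of 0 1] by (cases g; simp)+

lemma s14_pairing_one [simp]:
  "\<langle>s14_A, 1\<rangle> = 0" "\<langle>s14_B, 1\<rangle> = 0" "\<langle>s14_C, 1\<rangle> = 0" "\<langle>s14_D, 1\<rangle> = 0" "\<langle>s14_E, 1\<rangle> = 1" "\<langle>s14_K, 1\<rangle> = 1"
  using s14_pairing_basis[of 0 0] by simp_all

(* The case p = 0, u = q says that q is multiplicative. *)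
definition skew_on_gens :: "s14 \<Rightarrow> s14 \<Rightarrow> s14 \<Rightarrow> bool"
  where "skew_on_gens p q u \<longleftrightarrow>
    (\<forall>g f. \<langle>u, S14_gen g * f\<rangle> = \<langle>u, S14_gen g\<rangle> * \<langle>p, f\<rangle> + \<langle>q, S14_gen g\<rangle> * \<langle>u, f\<rangle>)"

text \<open>By linearity f may be a basis element, and both sides are read off the value tables. The
  twist of \<open>s14_D\<close> is \<open>s14_K\<close> because d a^k = (-1)^k a^k d; that of
  \<open>s14_B\<close> is \<open>s14_E\<close> because b is the only basis element on which
  \<open>s14_B\<close> does not vanish.\<close>

lemma skew_on_gens_s14:
  "skew_on_gens 1 1 s14_A" "skew_on_gens s14_E s14_E s14_B" "skew_on_gens s14_E s14_E s14_C"
  "skew_on_gens s14_K 1 s14_D" "skew_on_gens 0 s14_E s14_E" "skew_on_gens 0 s14_K s14_K"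
  unfolding skew_on_gens_def
  \<comment> \<open>Powers with exponent 0 or 1 get simplified away, so the tables are also supplied
    in the form they take at these exponents.\<close>
  by (intro allI; rename_tac g f; induct_tac f rule: S14_basis_induct;
      simp add: mult_scaleC_right S14_gen_mult_basis s14_pairing_basis
        s14_pairing_basis[where l = 0, simplified] s14_pairing_basis[where l = "Suc 0", simplified]
        s14_pairing_basis[where k = 0, simplified] s14_pairing_basis[where k = "Suc 0", simplified]
        S14_counit_basis S14_counit(2) algebra_simps split: gen.split del: power_Suc;
      simp add: algebra_simps)+

text \<open>Multiplicativity with a generator as left factor extends to all words by peeling off
  letters; the empty word uses <p, 1> = 1.\<close>

lemma is_comult_grouplike:
  assumes "skew_on_gens 0 p p" "\<langle>p, 1\<rangle> = 1"
  shows "is_comult p (p \<otimes> p)"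
proof -
  have "\<langle>p, f * g\<rangle> = \<langle>p, f\<rangle> * \<langle>p, g\<rangle>" for f g
  proof (induction f rule: S14_induct)
    case (word gs)
    show ?case
      using assms by (induction gs) (simp_all add: skew_on_gens_def mult.assoc)
  qed (simp_all add: distrib_right mult_scaleC_left)
  then show ?thesis by (simp add: is_comult_def)
qed

text \<open>The twisted Leibniz rule extends from generators to words by induction on the left
  factor; multiplicativity of p and q reassembles the terms. The empty word uses <u, 1> = 0 and <q,
  1> = 1.\<close>

lemma is_comult_skew:
  assumes skew: "skew_on_gens p q u" "skew_on_gens 0 p p" "skew_on_gens 0 q q"
    and one: "\<langle>u, 1\<rangle> = 0" "\<langle>p, 1\<rangle> = 1" "\<langle>q, 1\<rangle> = 1"
  shows "is_comult u (u \<otimes> p + q \<otimes> u)"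
proof -
  have p: "\<langle>p, f * g\<rangle> = \<langle>p, f\<rangle> * \<langle>p, g\<rangle>" for f g
    using is_comult_grouplike[OF skew(2) one(2)] by (simp add: is_comult_def)
  have q: "\<langle>q, f * g\<rangle> = \<langle>q, f\<rangle> * \<langle>q, g\<rangle>" for f g
    using is_comult_grouplike[OF skew(3) one(3)] by (simp add: is_comult_def)
  have u: "\<langle>u, S14_gen h * f\<rangle> = \<langle>u, S14_gen h\<rangle> * \<langle>p, f\<rangle> + \<langle>q, S14_gen h\<rangle> * \<langle>u, f\<rangle>" for h f
    using skew(1) by (simp add: skew_on_gens_def)
  have "\<langle>u, f * g\<rangle> = \<langle>u, f\<rangle> * \<langle>p, g\<rangle> + \<langle>q, f\<rangle> * \<langle>u, g\<rangle>" for f g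
  proof (induction f rule: S14_induct)
    case (word gs)
    show ?case by (induction gs) (simp_all add: one p q u mult.assoc algebra_simps)
  qed (simp_all add: distrib_right mult_scaleC_left algebra_simps)
  then show ?thesis by (simp add: is_comult_def)
qed

lemma is_comult_one: "is_comult 1 1"
  by (simp add: is_comult_def one_tensor_def algebra_homD[OF S14_counit(1)])

lemma is_comult_gens:
  "is_comult s14_A (s14_A \<otimes> 1 + 1 \<otimes> s14_A)"
  "is_comult s14_B (s14_B \<otimes> s14_E + s14_E \<otimes> s14_B)"
  "is_comult s14_C (s14_C \<otimes> s14_E + s14_E \<otimes> s14_C)"
  "is_comult s14_D (s14_D \<otimes> s14_K + 1 \<otimes> s14_D)"
  "is_comult s14_E (s14_E \<otimes> s14_E)"
  "is_comult s14_K (s14_K \<otimes> s14_K)"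
proof -
  have "skew_on_gens 0 1 1" "\<langle>1, 1\<rangle> = 1"
    by (simp_all add: skew_on_gens_def algebra_homD[OF S14_counit(1)])
  with skew_on_gens_s14 s14_pairing_one show
    "is_comult s14_A (s14_A \<otimes> 1 + 1 \<otimes> s14_A)"
    "is_comult s14_B (s14_B \<otimes> s14_E + s14_E \<otimes> s14_B)"
    "is_comult s14_C (s14_C \<otimes> s14_E + s14_E \<otimes> s14_C)"
    "is_comult s14_D (s14_D \<otimes> s14_K + 1 \<otimes> s14_D)"
    "is_comult s14_E (s14_E \<otimes> s14_E)"
    "is_comult s14_K (s14_K \<otimes> s14_K)"
    by (blast intro: is_comult_skew is_comult_grouplike)+
qed

section \<open>Existence and uniqueness of the coproduct, and the bialgebra structure\<close>

lemma is_comult_unique: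
  assumes "is_comult u s" "is_comult u t"
  shows "s = t"
  using tensor_pairing_nondegenerate[of "s - t"] assms by (simp add: is_comult_def)

lemma is_comult_add: "is_comult u s \<Longrightarrow> is_comult v t \<Longrightarrow> is_comult (u + v) (s + t)"
  and is_comult_diff: "is_comult u s \<Longrightarrow> is_comult v t \<Longrightarrow> is_comult (u - v) (s - t)"
  and is_comult_scale: "is_comult u s \<Longrightarrow> is_comult (c *\<^sub>C u) (c *\<^sub>C s)"
  by (simp_all add: is_comult_def)

lemma is_comult_exists: "\<exists>t. is_comult u t"
proof (induction u rule: s14_induct)
  case (gen u)
  then show ?case using is_comult_gens by blast
qed (blast intro: is_comult_one is_comult_add is_comult_scale is_comult_mult)+

lemma s14_comult_eq: "is_comult u t \<Longrightarrow> s14_comult u = t"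
  unfolding s14_comult_def is_comult_def[symmetric] by (blast intro: is_comult_unique)

lemma is_comult_s14_comult: "is_comult u (s14_comult u)"
  using is_comult_exists s14_comult_eq by blast

text \<open>Uniqueness turns the closure rules for \<open>is_comult\<close> into the homomorphism
  laws.\<close>

lemma algebra_hom_s14_comult: "algebra_hom s14_comult"
  by (intro algebra_homI clinearI s14_comult_eq is_comult_s14_comult is_comult_add
      is_comult_scale is_comult_mult is_comult_one)

lemmas s14_comult_gens = is_comult_gens[THEN s14_comult_eq]

lemma algebra_hom_s14_counit: "algebra_hom s14_counit"
  by (intro algebra_homI clinearI)
    (simp_all add: s14_counit_def scaleC_complex_def algebra_homD[OF S14_counit(1)])

lemma s14_counit_gens [simp]:
  "s14_counit s14_A = 0" "s14_counit s14_B = 0" "s14_counit s14_C = 0" "s14_counit s14_D = 0"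
  "s14_counit s14_E = 1" "s14_counit s14_K = 1"
  by (simp_all add: s14_counit_def)

text \<open>Both sides of coassociativity and of each counit law are algebra homomorphisms, so
  comparing them on the generators, whose coproducts are explicit, suffices.\<close>

lemma bialgebra_s14: "bialgebra s14_comult s14_counit"
  unfolding bialgebra_def
proof (intro conjI allI)
  note comult = algebra_hom_s14_comult and counit = algebra_hom_s14_counit
  note [simp] = algebra_homD[OF comult] algebra_homD[OF counit]
    clinearD[OF algebra_homD(1)[OF comult]] clinearD[OF algebra_homD(1)[OF counit]] s14_comult_gens
  have id: "clinear (id :: s14 \<Rightarrow> s14)" by (rule algebra_homD(1)[OF algebra_hom_id])
  show "algebra_hom s14_comult" "algebra_hom s14_counit" by (rule comult counit)+
  fix u
  show "tensor_assoc (tensor_map s14_comult id (s14_comult u)) =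
    tensor_map id s14_comult (s14_comult u)"
  proof (rule s14_hom_eqI[where u = u])
    show "algebra_hom (\<lambda>u. tensor_assoc (tensor_map s14_comult id (s14_comult u)))"
      by (intro algebra_hom_compose[OF algebra_hom_tensor_assoc]
          algebra_hom_compose[OF algebra_hom_tensor_map] comult algebra_hom_id)
    show "algebra_hom (\<lambda>u. tensor_map id s14_comult (s14_comult u))"
      by (intro algebra_hom_compose[OF algebra_hom_tensor_map] comult algebra_hom_id)
    fix v
    note [simp] = clinearD[OF clinear_tensor_assoc] tensor_more_simps tensor_simps id
      clinearD[OF clinear_tensor_map[OF id algebra_homD(1)[OF comult]]]
      clinearD[OF clinear_tensor_map[OF algebra_homD(1)[OF comult] id]] one_tensor_def
    assume "v \<in> {s14_A, s14_B, s14_C, s14_D, s14_E, s14_K}"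
    then show "tensor_assoc (tensor_map s14_comult id (s14_comult v)) =
      tensor_map id s14_comult (s14_comult v)"
      by (elim insertE emptyE) simp_all
  qed
  have l: "cbilinear (\<lambda>u v :: s14. s14_counit u *\<^sub>C v)"
    and r: "cbilinear (\<lambda>u v :: s14. s14_counit v *\<^sub>C u)"
    by (intro cbilinear_scale_left cbilinear_scale_right algebra_homD(1) counit)+
  note [simp] = tensor_lift_tensor[OF l] tensor_lift_simps[OF l]
    tensor_lift_tensor[OF r] tensor_lift_simps[OF r] scaleC_one
  have hom: "algebra_hom (tensor_lift (\<lambda>u v :: s14. s14_counit u *\<^sub>C v))"
    "algebra_hom (tensor_lift (\<lambda>u v :: s14. s14_counit v *\<^sub>C u))"
    by (intro algebra_hom_tensor_lift l r;
        simp add: mult_scaleC_left mult_scaleC_right scaleC_scaleC mult.commute)+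
  have "tensor_lift (\<lambda>u v. s14_counit u *\<^sub>C v) (s14_comult v) = v"
    "tensor_lift (\<lambda>u v. s14_counit v *\<^sub>C u) (s14_comult v) = v"
    if "v \<in> {s14_A, s14_B, s14_C, s14_D, s14_E, s14_K}" for v
    using that by (elim insertE emptyE; simp)+
  with s14_hom_eqI[OF algebra_hom_compose[OF hom(1) comult] algebra_hom_id, of u]
    s14_hom_eqI[OF algebra_hom_compose[OF hom(2) comult] algebra_hom_id, of u]
  show "tensor_lift (\<lambda>u v. s14_counit u *\<^sub>C v) (s14_comult u) = u"
    "tensor_lift (\<lambda>u v. s14_counit v *\<^sub>C u) (s14_comult u) = u"
    by simp_all
qed


section \<open>The relations\<close>

text \<open>Since <u, h f> = <u, h> <p, f> + <q, h> <u, f>, vanishing on 1 and on the generators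
  propagates to all words.\<close>

lemma skew_primitive_eq_zero:
  assumes comult: "is_comult u (u \<otimes> p + q \<otimes> u)"
    and zero: "\<langle>u, 1\<rangle> = 0" "\<langle>u, S14_a\<rangle> = 0" "\<langle>u, S14_b\<rangle> = 0" "\<langle>u, S14_c\<rangle> = 0" "\<langle>u, S14_d\<rangle> = 0"
  shows "u = 0"
proof (rule s14_eqI)
  fix f
  have mult: "\<langle>u, f * g\<rangle> = \<langle>u, f\<rangle> * \<langle>p, g\<rangle> + \<langle>q, f\<rangle> * \<langle>u, g\<rangle>" for f g
    using comult by (simp add: is_comult_def)
  have gen: "\<langle>u, S14_gen h\<rangle> = 0" for h using zero by (cases h) auto
  show "\<langle>u, f\<rangle> = \<langle>0, f\<rangle>"
  proof (induction f rule: S14_induct)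
    case (word gs)
    show ?case by (induction gs) (simp_all add: zero mult gen)
  qed simp_all
qed

text \<open>The common remainder r cancels in the difference, which is then skew-primitive for the
  same p and q. Cross terms shared by two products go into r.\<close>

lemma skew_primitive_eqI:
  assumes "is_comult u (u \<otimes> p + q \<otimes> u + r)" "is_comult v (v \<otimes> p + q \<otimes> v + r)"
    and "\<langle>u, 1\<rangle> = \<langle>v, 1\<rangle>" "\<langle>u, S14_a\<rangle> = \<langle>v, S14_a\<rangle>" "\<langle>u, S14_b\<rangle> = \<langle>v, S14_b\<rangle>"
      "\<langle>u, S14_c\<rangle> = \<langle>v, S14_c\<rangle>" "\<langle>u, S14_d\<rangle> = \<langle>v, S14_d\<rangle>"
  shows "u = v"
proof -
  have "is_comult (u - v) ((u - v) \<otimes> p + q \<otimes> (u - v))"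
    using is_comult_diff[OF assms(1,2)] by (simp add: tensor_more_simps algebra_simps)
  from skew_primitive_eq_zero[OF this] show ?thesis using assms(3-) by simp
qed

text \<open>A grouplike functional is multiplicative, hence fixed by its values on generators;
  \<open>s14_E\<close> is the character killing all four.\<close>

lemma grouplike_eq_E:
  assumes "is_comult u (u \<otimes> u)" "\<langle>u, 1\<rangle> = 1"
    "\<langle>u, S14_a\<rangle> = 0" "\<langle>u, S14_b\<rangle> = 0" "\<langle>u, S14_c\<rangle> = 0" "\<langle>u, S14_d\<rangle> = 0"
  shows "u = s14_E"
proof (rule s14_eqI)
  fix f
  have gen: "\<langle>u, S14_gen h\<rangle> = 0" for h using assms by (cases h) auto
  show "\<langle>u, f\<rangle> = \<langle>s14_E, f\<rangle>"
  proof (induction f rule: S14_induct)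
    case (word gs)
    have "\<langle>p, f * g\<rangle> = \<langle>p, f\<rangle> * \<langle>p, g\<rangle>" if "is_comult p (p \<otimes> p)" for p f g
      using that by (simp add: is_comult_def)
    from this[OF assms(1)] this[OF is_comult_gens(5)] show ?case
      by (induction gs) (simp_all add: assms(2) gen)
  qed simp_all
qed

section \<open>Absorption by \<open>s14_E\<close>, and the elements primitive with respect to
  it\<close>

lemmas tensor_expand = tensor_mult_tensor distrib_left distrib_right tensor_more_simps add_ac

lemma s14_E_absorbs [simp]:
  "s14_E * s14_E = s14_E" "s14_K * s14_E = s14_E" "s14_E * s14_K = s14_E"
  by (rule grouplike_eq_E;
      use is_comult_gens(5,6)[THEN is_comult_mult, OF is_comult_gens(5)]
        is_comult_mult[OF is_comult_gens(5,6)] in \<open>simp add: tensor_mult_tensor\<close>)+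

(* These elements are supported in degree one, so a relation between them only has to be checked
   on a, b, c and d. *)
definition E_primitive :: "s14 \<Rightarrow> bool"
  where "E_primitive u \<longleftrightarrow> is_comult u (u \<otimes> s14_E + s14_E \<otimes> u)"

text \<open>Pairing the coproduct with 1 \<otimes> 1 gives <u, 1> = 2 <u, 1>.\<close>

lemma E_primitive_one: "E_primitive u \<Longrightarrow> \<langle>u, 1\<rangle> = 0"
  unfolding E_primitive_def is_comult_def by (metis (no_types, lifting) tensor_pairing_simps(1,2)
      s14_pairing_one(5) mult_1 mult_1_right add_cancel_left_left)

lemma E_primitive_eqI:
  assumes "E_primitive u" "E_primitive v" "\<langle>u, S14_a\<rangle> = \<langle>v, S14_a\<rangle>" "\<langle>u, S14_b\<rangle> = \<langle>v, S14_b\<rangle>"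
    "\<langle>u, S14_c\<rangle> = \<langle>v, S14_c\<rangle>" "\<langle>u, S14_d\<rangle> = \<langle>v, S14_d\<rangle>"
  shows "u = v"
  by (rule skew_primitive_eqI[where p = s14_E and q = s14_E and r = 0])
    (use assms in \<open>simp_all add: E_primitive_def[symmetric] E_primitive_one\<close>)

text \<open>Since \<open>s14_E\<close> is idempotent, the product is again primitive for
  \<open>s14_E\<close>. It vanishes on a, b, c, d because \<open>s14_E\<close> does and their
  coproducts involve generators only.\<close>

lemma E_primitive_E_zero:
  assumes "E_primitive u"
  shows "s14_E * u = 0" "u * s14_E = 0"
proof -
  note m = is_comult_mult[OF is_comult_gens(5) assms[unfolded E_primitive_def]]
    is_comult_mult[OF assms[unfolded E_primitive_def] is_comult_gens(5)]
  show "s14_E * u = 0" "u * s14_E = 0"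
    by (rule skew_primitive_eq_zero[where p = s14_E and q = s14_E];
        use m E_primitive_one[OF assms] in \<open>simp add: tensor_expand\<close>)+
qed

text \<open>Multiplying by the grouplike \<open>s14_E\<close> replaces the outer factors 1 and
  \<open>s14_K\<close> in the coproducts by \<open>s14_E\<close>, so the products are primitive for
  \<open>s14_E\<close> and vanish on generators.\<close>

lemma s14_A_E_zero: "s14_E * s14_A = 0" "s14_A * s14_E = 0"
  and s14_D_E_zero: "s14_E * s14_D = 0" "s14_D * s14_E = 0"
  by (rule skew_primitive_eq_zero[where p = s14_E and q = s14_E];
      use is_comult_mult[OF is_comult_gens(5,1)] is_comult_mult[OF is_comult_gens(1,5)]
        is_comult_mult[OF is_comult_gens(5,4)] is_comult_mult[OF is_comult_gens(4,5)]
      in \<open>simp add: tensor_expand\<close>)+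

lemma E_primitive_B_C: "E_primitive s14_B" "E_primitive s14_C"
  by (simp_all add: E_primitive_def is_comult_gens)

text \<open>In the product of the two coproducts every cross term contains \<open>s14_E\<close>
  times an element it annihilates, and \<open>s14_K\<close> is absorbed by \<open>s14_E\<close>.
  Hence products with a factor \<open>s14_B\<close> or \<open>s14_C\<close> are handled by a check
  on a, b, c, d.\<close>

lemma E_primitive_mult:
  assumes "E_primitive u"
  shows "E_primitive v \<Longrightarrow> E_primitive (u * v)"
    "E_primitive (s14_A * u)" "E_primitive (u * s14_A)"
    "E_primitive (s14_D * u)" "E_primitive (u * s14_D)"
    "E_primitive (s14_K * u)" "E_primitive (u * s14_K)" "E_primitive (- u)"
proof -
  note u = assms[unfolded E_primitive_def]
  note zero = E_primitive_E_zero[OF assms] s14_A_E_zero s14_D_E_zero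
  show "E_primitive (u * v)" if "E_primitive v"
    using is_comult_mult[OF u that[unfolded E_primitive_def]] zero E_primitive_E_zero[OF that]
    by (simp add: E_primitive_def tensor_expand)
  show "E_primitive (s14_A * u)" "E_primitive (s14_D * u)" "E_primitive (s14_K * u)"
    using is_comult_gens(1,4,6)[THEN is_comult_mult, OF u] zero
    by (simp_all add: E_primitive_def tensor_expand)
  show "E_primitive (u * s14_A)" "E_primitive (u * s14_D)" "E_primitive (u * s14_K)"
    using is_comult_gens(1,4,6)[THEN is_comult_mult[OF u]] zero
    by (simp_all add: E_primitive_def tensor_expand)
  show "E_primitive (- u)"
    using is_comult_scale[OF u, of "- 1"]
    by (simp add: E_primitive_def tensor_more_simps scaleC_one)
qed

lemmas E_primitive_intros = E_primitive_B_C E_primitive_mult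

section \<open>Commutation and product relations among the generators\<close>

lemma s14_A_K: "s14_A * s14_K = s14_K * s14_A"
  by (rule skew_primitive_eqI[where p = s14_K and q = s14_K and r = 0];
      use is_comult_mult[OF is_comult_gens(1,6)] is_comult_mult[OF is_comult_gens(6,1)]
      in \<open>simp add: tensor_expand\<close>)

lemma s14_D_K: "s14_D * s14_K = s14_K * s14_D"
  \<comment> \<open>Multiplying the coproduct of \<open>s14_D\<close> by K \<otimes> K turns its
    outer factors K and 1 into K K and K.\<close>
  by (rule skew_primitive_eqI[where p = "s14_K * s14_K" and q = s14_K and r = 0];
      use is_comult_mult[OF is_comult_gens(4,6)] is_comult_mult[OF is_comult_gens(6,4)]
      in \<open>simp add: tensor_expand\<close>)

lemma s14_A_D: "s14_A * s14_D = s14_D * s14_A"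
  \<comment> \<open>Here r collects the cross terms of the two products of coproducts; they agree
    because \<open>s14_A\<close> commutes with \<open>s14_K\<close>.\<close>
  by (rule skew_primitive_eqI[where p = s14_K and q = 1
        and r = "s14_A \<otimes> s14_D + s14_D \<otimes> (s14_K * s14_A)"];
      use is_comult_mult[OF is_comult_gens(1,4)] is_comult_mult[OF is_comult_gens(4,1)]
      in \<open>simp add: tensor_expand s14_A_K\<close>)

text \<open>Every side has a factor \<open>s14_B\<close> or \<open>s14_C\<close>, so four values
  decide. The coproduct of c contains d \<otimes> b - b \<otimes> d, whence the sign between D B and
  B D; that of a contains b \<otimes> b and d \<otimes> d with coefficient 1, so B B and D D act on
  \<open>s14_B\<close> as the identity.\<close>

lemma s14_B_C_relations:
  "s14_C = s14_D * s14_B" "s14_D * s14_B = - (s14_B * s14_D)"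
  "s14_A * s14_B = s14_B" "s14_B * s14_A = s14_B" "s14_A * s14_C = s14_C * s14_A"
  "s14_D * (s14_D * s14_B) = s14_B" "s14_B * (s14_B * s14_B) = s14_B"
  by (rule E_primitive_eqI; (intro E_primitive_intros | simp))+

section \<open>The Casimir elements\<close>

lemma s14_A_central: "s14_A * u = u * s14_A"
proof (rule s14_central)
  fix u
  assume "u \<in> {s14_A, s14_B, s14_C, s14_D, s14_E, s14_K}"
  then show "s14_A * u = u * s14_A"
    by (auto simp: s14_A_K s14_A_D s14_A_E_zero s14_B_C_relations(3-5))
qed

text \<open>B B is primitive for \<open>s14_E\<close>, which therefore annihilates it, and
  \<open>s14_A\<close> is central. For the other generators both products are again primitive for
  \<open>s14_E\<close>, leaving four values to compare.\<close>

lemma s14_B_squared_central: "s14_B ^ 2 * u = u * s14_B ^ 2"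
proof (rule s14_central)
  note B2 = E_primitive_mult(1)[OF E_primitive_B_C(1) E_primitive_B_C(1)]
  fix u
  assume "u \<in> {s14_A, s14_B, s14_C, s14_D, s14_E, s14_K}"
  moreover have "s14_B * s14_B * u = u * (s14_B * s14_B)"
    if "u \<in> {s14_B, s14_C, s14_D, s14_K}" for u
    using that
    by (elim insertE emptyE; simp only:)
      (rule E_primitive_eqI; (intro E_primitive_intros | simp))+
  ultimately show "s14_B ^ 2 * u = u * s14_B ^ 2"
    unfolding power2_eq_square
    by (elim insertE emptyE) (simp_all add: s14_A_central E_primitive_E_zero[OF B2])
qed

text \<open>Only against \<open>s14_B\<close> and \<open>s14_C\<close> are the products compared as
  elements primitive for \<open>s14_E\<close>. Otherwise \<open>s14_A\<close> is central,
  \<open>s14_K\<close> commutes with \<open>s14_D\<close>, and \<open>s14_E\<close> annihilates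
  it.\<close>

lemma s14_D_squared_central: "s14_D ^ 2 * u = u * s14_D ^ 2"
proof (rule s14_central)
  fix u
  assume "u \<in> {s14_A, s14_B, s14_C, s14_D, s14_E, s14_K}"
  moreover have "s14_D * (s14_D * u) = u * s14_D * s14_D" if "u \<in> {s14_B, s14_C}" for u
    using that
    by (elim insertE emptyE; simp only:)
      (rule E_primitive_eqI; (intro E_primitive_intros | simp))+
  moreover have "s14_D * (s14_D * s14_K) = s14_K * s14_D * s14_D"
    by (simp add: s14_D_K) (simp add: s14_D_K flip: mult.assoc)
  moreover have "s14_D * (s14_D * s14_E) = s14_E * s14_D * s14_D"
    by (simp add: s14_D_E_zero)
  ultimately show "s14_D ^ 2 * u = u * s14_D ^ 2"
    unfolding power2_eq_square
    by (elim insertE emptyE) (simp_all add: mult.assoc flip: s14_A_central)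
qed

(* An antipode would make the grouplike E invertible, but E annihilates A. *)
lemma not_hopf_algebra_s14: "\<not> hopf_algebra s14_comult s14_counit"
proof
  assume "hopf_algebra s14_comult s14_counit"
  then obtain S where S: "clinear S"
    "tensor_lift (\<lambda>y z. S y * z) (s14_comult s14_E) = s14_counit s14_E *\<^sub>C 1"
    by (auto simp: hopf_algebra_def antipode_def)
  have "cbilinear (\<lambda>y z. S y * z)"
    by (intro cbilinearI)
      (simp_all add: clinearD[OF S(1)] distrib_left distrib_right mult_scaleC_left mult_scaleC_right)
  with S(2) have "S s14_E * s14_E = 1" by (simp add: s14_comult_gens scaleC_one)
  then have "s14_A = S s14_E * (s14_E * s14_A)" by (simp flip: mult.assoc)
  then have "\<langle>s14_A, S14_a\<rangle> = 0" by (simp add: s14_A_E_zero)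
  then show False by simp
qed

theorem proposition2:
  shows
    "(s14_C = s14_D * s14_B \<and> s14_D * s14_B = - (s14_B * s14_D) \<and>
      s14_A * s14_D - s14_D * s14_A = 0 \<and>
      s14_A * s14_B = s14_B * s14_A \<and> s14_B * s14_A = s14_D ^ 2 * s14_B \<and>
      s14_D ^ 2 * s14_B = s14_B ^ 3 \<and> s14_B ^ 3 = s14_B \<and>
      (\<forall>Z \<in> {s14_A, s14_B, s14_D}. s14_E * Z = 0 \<and> Z * s14_E = 0)) \<and>
     ((\<forall>u f g. tensor_pairing (s14_comult u) (f \<otimes> g) = \<langle>u, f * g\<rangle>) \<and>
      s14_comult s14_A = s14_A \<otimes> 1 + 1 \<otimes> s14_A \<and>
      s14_comult s14_B = s14_B \<otimes> s14_E + s14_E \<otimes> s14_B \<and>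
      s14_comult s14_D = s14_D \<otimes> s14_K + 1 \<otimes> s14_D \<and>
      s14_comult s14_E = s14_E \<otimes> s14_E) \<and>
     ((\<forall>Z \<in> {s14_A, s14_B, s14_D}. s14_counit Z = 0) \<and> s14_counit s14_E = 1) \<and>
     (\<forall>Z \<in> {s14_A, s14_B ^ 2, s14_D ^ 2}. \<forall>u. Z * u = u * Z) \<and>
     bialgebra s14_comult s14_counit \<and> \<not> hopf_algebra s14_comult s14_counit"
proof (intro conjI)
  show "s14_C = s14_D * s14_B" "s14_D * s14_B = - (s14_B * s14_D)"
    by (rule s14_B_C_relations)+
  show "s14_A * s14_D - s14_D * s14_A = 0" by (simp add: s14_A_D)
  show "s14_A * s14_B = s14_B * s14_A" "s14_B * s14_A = s14_D ^ 2 * s14_B"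
    "s14_D ^ 2 * s14_B = s14_B ^ 3" "s14_B ^ 3 = s14_B"
    by (simp_all add: power2_eq_square power3_eq_cube mult.assoc s14_B_C_relations(3-))
  show "\<forall>Z \<in> {s14_A, s14_B, s14_D}. s14_E * Z = 0 \<and> Z * s14_E = 0"
    by (simp add: s14_A_E_zero s14_D_E_zero E_primitive_E_zero E_primitive_B_C)
  show "\<forall>u f g. tensor_pairing (s14_comult u) (f \<otimes> g) = \<langle>u, f * g\<rangle>"
    using is_comult_s14_comult by (simp add: is_comult_def)
qed (simp_all add: s14_comult_gens s14_A_central s14_B_squared_central s14_D_squared_central
    bialgebra_s14 not_hopf_algebra_s14)

end
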